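(* (Team variance derivative formula.) Consider the $n$-player stochastic game with separately controlled chains described in the context. For any two stationary deterministic policies $u=(u_1,\dots,u_n)$ and $u'=(u'_1,\dots,u'_n)$ in $\mathcal U^{\rm SD}$, let $\delta^{u'}_u$, $0\le\delta\le1$, be the mixed policy in which each player $i$ adopts $u_i$ with probability $1-\delta$ and $u'_i$ with probability $\delta$. Then the (one-sided) derivative of the team variance in $\delta$ at $\delta=0$ exists and $$\frac{\partial J^{\delta^{u'}_u}_\sigma}{\partial\delta}\Big|_{\delta=0}=\sum_{i=1}^n\boldsymbol\pi_i^{u_i}\Big[(\boldsymbol P_i^{u'_i}-\boldsymbol P_i^{u_i})\boldsymbol g_i^{u_i}+(\boldsymbol r_i^{u'_i}-\mu^u\boldsymbol 1)^2_\odot-(\boldsymbol r_i^{u_i}-\mu^u\boldsymbol 1)^2_\odot\Big],$$ where $\boldsymbol g_i^{u_i}$ is the performance potential of player $i$ under $u_i$ for the cost $(r_i-y)^2$ with $y=\mu^u$.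
   Context: Game. There are players $\mathcal I=\{1,\dots,n\}$. Player $i$ has a finite state space $\mathcal S_i$ and a finite action space $\mathcal A_i$. Time is discrete, $t=0,1,2,\dots$; the state and action of player $i$ at time $t$ are $s_{i,t}$, $a_{i,t}$. Separately controlled chains: player $i$'s state moves according to a transition probability $p_i(s_i'\mid s_i,a_i)$ depending only on its own state and action, player $i$'s reward is $r_i(s_i,a_i)\in\mathbb R$, and the joint transition probability is $\prod_{i=1}^n p_i(s_i'\mid s_i,a_i)$. $\mathcal U_i^{\rm SD}$ is the set of stationary deterministic policies of player $i$, i.e. maps $u_i:\mathcal S_i\to\mathcal A_i$ with $a_{i,t}=u_i(s_{i,t})$, and $\mathcal U^{\rm SD}=\times_{i=1}^n\mathcal U_i^{\rm SD}$. Standing assumption: for every $i$ and $u_i\in\mathcal U_i^{\rm SD}$ the Markov chain on $\mathcal S_i$ with transition probabilities $p_i(s'\mid s,u_i(s))$ is ergodic (irreducible and aperiodic). Mixed policy. Under $\delta^{u'}_u$, at each time $t$ each player $i$, independently of the other players and of the past, uses action $u_i(s_{i,t})$ with probability $1-\delta$ and $u'_i(s_{i,t})$ with probability $\delta$. This is a stationary randomized policy. Criterion. The team mean and team variance under a stationary (possibly randomized) policy $u$ are $$\mu^u=\mathbb E^u\Big\{\frac1n\sum_{i=1}^n\lim_{T\to\infty}\frac1T\sum_{t=0}^{T-1}r_i(s_{i,t},a_{i,t})\Big\},\qquad J^u_\sigma=\mathbb E^u\Big\{\sum_{i=1}^n\lim_{T\to\infty}\frac1T\sum_{t=0}^{T-1}[r_i(s_{i,t},a_{i,t})-\mu^u]^2\Big\}.$$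 Vector notation. For $u_i\in\mathcal U_i^{\rm SD}$: $\boldsymbol P_i^{u_i}$ is the matrix with entries $p_i(s'\mid s,u_i(s))$, $s,s'\in\mathcal S_i$; $\boldsymbol\pi_i^{u_i}$ is the row vector of its stationary distribution; $\boldsymbol r_i^{u_i}$ is the column vector with entries $r_i(s,u_i(s))$; $\boldsymbol 1$ is the all-ones column vector; $(\cdot)^2_\odot$ is the elementwise square. The performance potential of player $i$ under $u_i$ (for parameter $y\in\mathbb R$) is the column vector $\boldsymbol g_i^{u_i}$ with entries $$g_i^{u_i}(s)=\mathbb E\Big\{\sum_{t=0}^\infty\big([r_i(s_{i,t},a_{i,t})-y]^2-J^{u_i}_{\sigma,i}(y)\big)\,\Big|\,s_{i,0}=s\Big\},\qquad s\in\mathcal S_i,\ a_{i,t}=u_i(s_{i,t}),$$ where $J^{u_i}_{\sigma,i}(y)=\mathbb E^{u_i}\{\lim_{T\to\infty}\frac1T\sum_{t=0}^{T-1}[r_i(s_{i,t},a_{i,t})-y]^2\}$. The infinite sum is understood as the limit of the expectations of its partial sums. *)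

theory Defs
  imports "HOL-Probability.Probability"
begin

section \<open>Markov chains on trajectory space\<close>

text \<open>
  Law, on the space of trajectories, of the Markov chain with initial distribution \<open>\<nu>\<close> and
  transition kernel \<open>K\<close>, obtained from the Ionescu-Tulcea extension theorem.
  The lemma \<open>markov_law_cylinder\<close> below gives its finite-dimensional distributions.
\<close>

definition markov_kernels :: "'x pmf \<Rightarrow> ('x \<Rightarrow> 'x pmf) \<Rightarrow> nat \<Rightarrow> (nat \<Rightarrow> 'x) \<Rightarrow> 'x measure" where
  "markov_kernels \<nu> K t \<omega> = (case t of 0 \<Rightarrow> measure_pmf \<nu> | Suc k \<Rightarrow> measure_pmf (K (\<omega> k)))"

definition markov_law :: "'x pmf \<Rightarrow> ('x \<Rightarrow> 'x pmf) \<Rightarrow> (nat \<Rightarrow> 'x) measure" where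
  "markov_law \<nu> K =
     projective_family.lim UNIV
       (Ionescu_Tulcea.CI (markov_kernels \<nu> K) (\<lambda>_. count_space UNIV))
       (\<lambda>_. count_space UNIV)"

lemma Ionescu_Tulcea_markov:
  fixes K :: "'x \<Rightarrow> 'x pmf"
  shows "Ionescu_Tulcea (markov_kernels \<nu> K) (\<lambda>_. count_space UNIV)"
proof (rule Ionescu_Tulcea.intro)
  fix i :: nat
  have K: "(\<lambda>x. measure_pmf (L x)) \<in> measurable (count_space UNIV) (subprob_algebra (count_space UNIV))"
    for L :: "'x \<Rightarrow> 'x pmf"
    by (rule measurable_count_space_eq1[THEN iffD2]) (simp add: measure_pmf_in_subprob_algebra)
  show "markov_kernels \<nu> K i \<in> measurable (PiM {0..<i} (\<lambda>_. count_space UNIV))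
          (subprob_algebra (count_space UNIV))"
  proof (cases i)
    case 0
    then have "markov_kernels \<nu> K i = (\<lambda>_. measure_pmf \<nu>)"
      by (simp add: markov_kernels_def[abs_def])
    then show ?thesis
      by (simp only:) (rule measurable_const, simp add: measure_pmf_in_subprob_algebra)
  next
    case (Suc k)
    then have eq: "markov_kernels \<nu> K i = (\<lambda>\<omega>. measure_pmf (K (\<omega> k)))"
      by (simp add: markov_kernels_def[abs_def])
    have "k \<in> {0..<i}" using Suc by simp
    from measurable_compose[OF measurable_component_singleton[OF this] K]
    show ?thesis unfolding eq .
  qed
next
  fix i :: nat and \<omega> :: "nat \<Rightarrow> 'x"
  show "prob_space (markov_kernels \<nu> K i \<omega>)"
    by (cases i) (simp_all add: markov_kernels_def measure_pmf.prob_space_axioms)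
qed

lemma sets_markov_law [measurable_cong]:
  "sets (markov_law \<nu> K) = sets (PiM UNIV (\<lambda>_. count_space UNIV))"
proof -
  interpret Ionescu_Tulcea "markov_kernels \<nu> K" "\<lambda>_. count_space UNIV"
    by (rule Ionescu_Tulcea_markov)
  show ?thesis unfolding markov_law_def by (rule PF.sets_lim)
qed

lemma space_markov_law [simp]: "space (markov_law \<nu> K) = UNIV"
  using sets_eq_imp_space_eq[OF sets_markov_law[of \<nu> K]] by (simp add: space_PiM)

lemma prob_space_markov_law:
  fixes K :: "'x \<Rightarrow> 'x pmf"
  shows "prob_space (markov_law \<nu> K)"
proof
  interpret Ionescu_Tulcea "markov_kernels \<nu> K" "\<lambda>_. count_space UNIV"
    by (rule Ionescu_Tulcea_markov)
  let ?E = "PiM {} (\<lambda>_. count_space UNIV) :: (nat \<Rightarrow> 'x) measure"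
  have E: "space ?E \<in> sets ?E" by (rule sets.top)
  have "{} \<subseteq> (UNIV :: nat set)" by (rule empty_subsetI)
  note CI = PF.prob_space_P[OF finite.emptyI this] PF.space_P[OF finite.emptyI this]
  have emb: "PF.emb UNIV {} (space ?E) = UNIV"
    unfolding prod_emb_def by (auto simp: space_PiM)
  have "emeasure (markov_law \<nu> K) (PF.emb UNIV {} (space ?E)) = emeasure (CI {}) (space (CI {}))"
    unfolding markov_law_def CI(2) using lim[OF finite.emptyI E] .
  then show "emeasure (markov_law \<nu> K) (space (markov_law \<nu> K)) = 1"
    unfolding emb space_markov_law prob_space.emeasure_space_1[OF CI(1)] .
qed

lemma markov_law_cylinder:
  fixes K :: "'x \<Rightarrow> 'x pmf"
  shows "emeasure (markov_law \<nu> K) {\<omega>. \<forall>t\<le>T. \<omega> t = x t} =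
         ennreal (pmf \<nu> (x 0) * (\<Prod>t<T. pmf (K (x t)) (x (Suc t))))"
proof -
  let ?M = "\<lambda>_::nat. count_space (UNIV :: 'x set)"
  interpret Ionescu_Tulcea "markov_kernels \<nu> K" ?M
    by (rule Ionescu_Tulcea_markov)
  define w where "w n = restrict x {0..<n}" for n
  have w_sets [measurable]: "{w n} \<in> sets (PiM {0..<n} ?M)" for n
  proof -
    have "{w n} = Pi\<^sub>E {0..<n} (\<lambda>t. {x t})"
      by (auto simp: w_def PiE_iff extensional_def fun_eq_iff)
    also have "\<dots> \<in> sets (PiM {0..<n} ?M)" by (intro sets_PiM_I_finite) auto
    finally show ?thesis .
  qed
  define q where "q n = (case n of 0 \<Rightarrow> pmf \<nu> (x 0) | Suc k \<Rightarrow> pmf (K (x k)) (x (Suc k)))" for n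
  have q0: "q n \<ge> 0" for n by (auto simp: q_def split: nat.split)
  have C: "emeasure (C 0 n (\<lambda>_. undefined)) {w n} = ennreal (\<Prod>t<n. q t)" for n
  proof (induction n)
    case 0
    have "w 0 = (\<lambda>_. undefined)" by (auto simp: w_def)
    then show ?case by (simp add: PiM_empty)
  next
    case (Suc n)
    have eP: "emeasure (eP n y) {w (Suc n)} = ennreal (q n) * indicator {w n} y"
      if y: "y \<in> space (PiM {0..<n} ?M)" for y
    proof -
      have yext: "y \<in> extensional {0..<n}" using y by (auto simp: space_PiM PiE_iff)
      have upd: "fun_upd y n z = w (Suc n) \<longleftrightarrow> y = w n \<and> z = x n" for z
      proof
        assume *: "fun_upd y n z = w (Suc n)"
        have "y = w n"
        proof (rule HOL.ext)
          fix t show "y t = w n t"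
            using fun_cong[OF *, of t] extensional_arb[OF yext, of t]
            by (cases "t < n"; cases "t = n") (simp_all add: w_def)
        qed
        moreover have "z = x n" using fun_cong[OF *, of n] by (simp add: w_def)
        ultimately show "y = w n \<and> z = x n" by (rule conjI)
      next
        assume "y = w n \<and> z = x n"
        then show "fun_upd y n z = w (Suc n)"
          by (intro HOL.ext) (simp add: w_def)
      qed
      have "emeasure (eP n y) {w (Suc n)} = markov_kernels \<nu> K n y {z. y = w n \<and> z = x n}"
        using w_sets[of "Suc n"] by (subst emeasure_eP[OF y]) (auto simp: upd vimage_def)
      also have "\<dots> = ennreal (q n) * indicator {w n} y"
        by (cases "y = w n"; cases n)
           (auto simp: markov_kernels_def q_def w_def emeasure_pmf_single)
      finally show ?thesis .
    qed
    have sp: "space (C 0 n (\<lambda>_. undefined)) = space (PiM {0..<n} ?M)"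
      using space_C[of "\<lambda>_. undefined" 0 n] by (simp add: space_PiM)
    have st: "sets (C 0 n (\<lambda>_. undefined)) = sets (PiM {0..<n} ?M)"
      using sets_C[of "\<lambda>_. undefined" 0 n] by (simp add: space_PiM)
    have meas: "eP n \<in> measurable (C 0 n (\<lambda>_. undefined)) (subprob_algebra (PiM {0..<Suc n} ?M))"
      using measurable_eP[of n] unfolding measurable_cong_sets[OF st refl] .
    have ne: "space (C 0 n (\<lambda>_. undefined)) \<noteq> {}" unfolding sp by (auto simp: space_PiM PiE_eq_empty_iff)
    have "emeasure (C 0 (Suc n) (\<lambda>_. undefined)) {w (Suc n)} =
          (\<integral>\<^sup>+ y. emeasure (eP n y) {w (Suc n)} \<partial>C 0 n (\<lambda>_. undefined))"
      using emeasure_bind[OF ne meas w_sets] by simp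
    also have "\<dots> = (\<integral>\<^sup>+ y. ennreal (q n) * indicator {w n} y \<partial>C 0 n (\<lambda>_. undefined))"
      by (intro nn_integral_cong eP) (simp add: sp)
    also have "\<dots> = ennreal (q n) * emeasure (C 0 n (\<lambda>_. undefined)) {w n}"
      using w_sets[of n] by (subst nn_integral_cmult_indicator) (simp_all add: st)
    also have "\<dots> = ennreal (\<Prod>t<Suc n. q t)"
      using q0 by (simp add: Suc ennreal_mult prod_nonneg mult.commute)
    finally show ?case .
  qed
  have "(\<forall>t\<le>T. \<omega> t = x t) \<longleftrightarrow> restrict \<omega> {0..<Suc T} = w (Suc T)" for \<omega>
  proof
    assume *: "restrict \<omega> {0..<Suc T} = w (Suc T)"
    show "\<forall>t\<le>T. \<omega> t = x t"
    proof (intro allI impI)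
      fix t assume "t \<le> T"
      then show "\<omega> t = x t" using fun_cong[OF *, of t] by (simp add: w_def)
    qed
  qed (auto simp: w_def intro!: restrict_ext)
  then have "{\<omega>. \<forall>t\<le>T. \<omega> t = x t} = PF.emb UNIV {0..<Suc T} {w (Suc T)}"
    by (auto simp: prod_emb_def space_PiM)
  then have "emeasure (markov_law \<nu> K) {\<omega>. \<forall>t\<le>T. \<omega> t = x t} = emeasure (CI {0..<Suc T}) {w (Suc T)}"
    unfolding markov_law_def using lim[of "{0..<Suc T}" "{w (Suc T)}"] by simp
  also have "\<dots> = emeasure (C 0 (Suc T) (\<lambda>_. undefined)) {w (Suc T)}"
    using emeasure_CI[OF subset_refl w_sets] by (simp add: prod_emb_id w_def)
  also have "\<dots> = ennreal (\<Prod>t<Suc T. q t)" by (rule C)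
  also have "(\<Prod>t<Suc T. q t) = pmf \<nu> (x 0) * (\<Prod>t<T. pmf (K (x t)) (x (Suc t)))"
    by (subst prod.lessThan_Suc_shift) (simp add: q_def)
  finally show ?thesis .
qed

section \<open>Ergodicity and stationary distributions of finite chains\<close>

primrec n_step :: "('x \<Rightarrow> 'x pmf) \<Rightarrow> nat \<Rightarrow> 'x \<Rightarrow> 'x pmf" where
  "n_step K 0 x = return_pmf x"
| "n_step K (Suc m) x = bind_pmf (K x) (n_step K m)"

definition irreducible_chain :: "'x set \<Rightarrow> ('x \<Rightarrow> 'x pmf) \<Rightarrow> bool" where
  "irreducible_chain S K \<longleftrightarrow> (\<forall>x\<in>S. \<forall>y\<in>S. \<exists>m. pmf (n_step K m x) y > 0)"

definition aperiodic_chain :: "'x set \<Rightarrow> ('x \<Rightarrow> 'x pmf) \<Rightarrow> bool" where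
  "aperiodic_chain S K \<longleftrightarrow> (\<forall>x\<in>S. Gcd {m. m > 0 \<and> pmf (n_step K m x) x > 0} = 1)"

definition ergodic_chain :: "'x set \<Rightarrow> ('x \<Rightarrow> 'x pmf) \<Rightarrow> bool" where
  "ergodic_chain S K \<longleftrightarrow> irreducible_chain S K \<and> aperiodic_chain S K"

text \<open>Kernels are unconstrained outside the state space \<open>S\<close>, hence the support condition.\<close>

definition stationary_dist :: "'x set \<Rightarrow> ('x \<Rightarrow> 'x pmf) \<Rightarrow> 'x pmf" where
  "stationary_dist S K = (THE \<pi>. set_pmf \<pi> \<subseteq> S \<and> bind_pmf \<pi> K = \<pi>)"

section \<open>The game with separately controlled chains\<close>

text \<open>
  The players are \<open>{1..n}\<close>. Player \<open>i\<close> has transition kernel \<open>p i s a\<close> and reward \<open>r i s a\<close>.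
  A stationary randomized policy profile is a map \<open>w\<close>, where \<open>w i s\<close> is the distribution of
  player \<open>i\<close>'s action in its own state \<open>s\<close>. Joint states and joint actions are functions on the
  player indices; the players randomize and move independently, given the current joint state.
\<close>

definition deterministic_policy :: "(nat \<Rightarrow> 's \<Rightarrow> 'a) \<Rightarrow> nat \<Rightarrow> 's \<Rightarrow> 'a pmf" where
  "deterministic_policy u i s = return_pmf (u i s)"

definition mixed_policy ::
  "(nat \<Rightarrow> 's \<Rightarrow> 'a) \<Rightarrow> (nat \<Rightarrow> 's \<Rightarrow> 'a) \<Rightarrow> real \<Rightarrow> nat \<Rightarrow> 's \<Rightarrow> 'a pmf" where
  "mixed_policy u u' \<delta> i s = map_pmf (\<lambda>b. if b then u' i s else u i s) (bernoulli_pmf \<delta>)"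

definition joint_action ::
  "nat \<Rightarrow> (nat \<Rightarrow> 's \<Rightarrow> 'a pmf) \<Rightarrow> (nat \<Rightarrow> 's) \<Rightarrow> (nat \<Rightarrow> 'a) pmf" where
  "joint_action n w s = Pi_pmf {1..n} undefined (\<lambda>i. w i (s i))"

definition joint_transition ::
  "nat \<Rightarrow> (nat \<Rightarrow> 's \<Rightarrow> 'a \<Rightarrow> 's pmf) \<Rightarrow> (nat \<Rightarrow> 's) \<Rightarrow> (nat \<Rightarrow> 'a) \<Rightarrow> (nat \<Rightarrow> 's) pmf" where
  "joint_transition n p s a = Pi_pmf {1..n} undefined (\<lambda>i. p i (s i) (a i))"

definition attach_action ::
  "nat \<Rightarrow> (nat \<Rightarrow> 's \<Rightarrow> 'a pmf) \<Rightarrow> (nat \<Rightarrow> 's) \<Rightarrow> ((nat \<Rightarrow> 's) \<times> (nat \<Rightarrow> 'a)) pmf" where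
  "attach_action n w s = map_pmf (\<lambda>a. (s, a)) (joint_action n w s)"

text \<open>
  Law of the joint state-action trajectory under \<open>w\<close>, with initial joint state distributed
  according to \<open>\<nu>\<close>. For a trajectory \<open>\<omega>\<close>, \<open>fst (\<omega> t) i\<close> and \<open>snd (\<omega> t) i\<close> are the state and
  the action of player \<open>i\<close> at time \<open>t\<close>.
\<close>

definition team_law ::
  "nat \<Rightarrow> (nat \<Rightarrow> 's \<Rightarrow> 'a \<Rightarrow> 's pmf) \<Rightarrow> (nat \<Rightarrow> 's) pmf \<Rightarrow> (nat \<Rightarrow> 's \<Rightarrow> 'a pmf)
    \<Rightarrow> (nat \<Rightarrow> (nat \<Rightarrow> 's) \<times> (nat \<Rightarrow> 'a)) measure" where
  "team_law n p \<nu> w =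
     markov_law (bind_pmf \<nu> (attach_action n w))
       (\<lambda>(s, a). bind_pmf (joint_transition n p s a) (attach_action n w))"

definition time_average :: "(nat \<Rightarrow> real) \<Rightarrow> real" where
  "time_average x = lim (\<lambda>T. 1 / real T * (\<Sum>t<T. x t))"

definition team_mean ::
  "nat \<Rightarrow> (nat \<Rightarrow> 's \<Rightarrow> 'a \<Rightarrow> 's pmf) \<Rightarrow> (nat \<Rightarrow> 's \<Rightarrow> 'a \<Rightarrow> real) \<Rightarrow> (nat \<Rightarrow> 's) pmf
    \<Rightarrow> (nat \<Rightarrow> 's \<Rightarrow> 'a pmf) \<Rightarrow> real" where
  "team_mean n p r \<nu> w =
     (\<integral>\<omega>. 1 / real n * (\<Sum>i=1..n. time_average (\<lambda>t. r i (fst (\<omega> t) i) (snd (\<omega> t) i)))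
      \<partial>team_law n p \<nu> w)"

definition team_variance ::
  "nat \<Rightarrow> (nat \<Rightarrow> 's \<Rightarrow> 'a \<Rightarrow> 's pmf) \<Rightarrow> (nat \<Rightarrow> 's \<Rightarrow> 'a \<Rightarrow> real) \<Rightarrow> (nat \<Rightarrow> 's) pmf
    \<Rightarrow> (nat \<Rightarrow> 's \<Rightarrow> 'a pmf) \<Rightarrow> real" where
  "team_variance n p r \<nu> w =
     (\<integral>\<omega>. (\<Sum>i=1..n. time_average
              (\<lambda>t. (r i (fst (\<omega> t) i) (snd (\<omega> t) i) - team_mean n p r \<nu> w)\<^sup>2))
      \<partial>team_law n p \<nu> w)"

section \<open>A single player under a stationary deterministic policy\<close>

definition closed_loop :: "('s \<Rightarrow> 'a \<Rightarrow> 's pmf) \<Rightarrow> ('s \<Rightarrow> 'a) \<Rightarrow> 's \<Rightarrow> 's pmf" where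
  "closed_loop q v s = q s (v s)"

text \<open>
  Long-run cost of \<open>(\<rho> - y)\<^sup>2\<close> from initial state \<open>s\<close>, for a player with kernel \<open>q\<close>, reward
  \<open>\<rho>\<close> and policy \<open>v\<close>; by ergodicity the value does not depend on \<open>s\<close>.
\<close>

definition player_cost ::
  "('s \<Rightarrow> 'a \<Rightarrow> 's pmf) \<Rightarrow> ('s \<Rightarrow> 'a \<Rightarrow> real) \<Rightarrow> ('s \<Rightarrow> 'a) \<Rightarrow> real \<Rightarrow> 's \<Rightarrow> real" where
  "player_cost q \<rho> v y s =
     (\<integral>\<omega>. time_average (\<lambda>t. (\<rho> (\<omega> t) (v (\<omega> t)) - y)\<^sup>2)
      \<partial>markov_law (return_pmf s) (closed_loop q v))"

definition potential ::
  "('s \<Rightarrow> 'a \<Rightarrow> 's pmf) \<Rightarrow> ('s \<Rightarrow> 'a \<Rightarrow> real) \<Rightarrow> ('s \<Rightarrow> 'a) \<Rightarrow> real \<Rightarrow> 's \<Rightarrow> real" where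
  "potential q \<rho> v y s =
     lim (\<lambda>T. \<integral>\<omega>. (\<Sum>t<T. (\<rho> (\<omega> t) (v (\<omega> t)) - y)\<^sup>2 - player_cost q \<rho> v y s)
              \<partial>markov_law (return_pmf s) (closed_loop q v))"

end

theory Submission
  imports Defs "HOL-Library.Discrete_Functions"
begin

text \<open>
  The proof has a probabilistic half, which turns the expected time averages that define the team
  mean and variance into stationary expectations, and an algebraic half, which differentiates these.

  Both rest on the Poisson equation \<open>f - c = h - K h\<close> of a finite chain \<open>K\<close>, where \<open>c\<close> is the
  stationary mean of \<open>f\<close>. Irreducibility and aperiodicity make some power of the transition matrix
  strictly positive (\<open>ergodic_chain_primitive\<close>), so that the iterates \<open>K\<^sup>t f\<close> become constant
  at a geometric rate; the sum \<open>h\<close> of the \<open>K\<^sup>t f - c\<close> solves the equation (\<open>poisson_equation\<close>).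
  For the cost \<open>(r - y)\<^sup>2\<close> this sum is the performance potential (\<open>potential_poisson\<close>).

  Probabilistic half. Along a trajectory the Poisson equation writes the partial sums of \<open>f - c\<close> as a
  bounded telescoping term plus a martingale with bounded increments, and the time averages of the
  latter tend to \<open>0\<close> almost surely (\<open>markov_law_ergodic\<close>). A reward of player \<open>i\<close> is a function of
  the joint state-action chain, and a solution of the Poisson equation of the single chain of
  player \<open>i\<close> lifts to one of the joint chain (\<open>AE_player_average\<close>). Hence ergodicity of the joint chain,
  which would be awkward on an infinite joint state space, never enters.

  Algebraic half. Let \<open>\<pi>\<^sub>\<delta>\<close> be the stationary distribution of a player under the mixed policy, and
  \<open>g\<close> a solution of the Poisson equation at \<open>\<delta> = 0\<close>. Integrating that equation against \<open>\<pi>\<^sub>\<delta>\<close>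
  gives the exact difference formula (\<open>long_run_average_difference\<close>): the long-run averages at \<open>\<delta>\<close>
  and at \<open>0\<close> differ by \<open>\<delta>\<close> times the \<open>\<pi>\<^sub>\<delta>\<close>-mean of \<open>(P' - P) g + f' - f\<close>. It also shows that
  \<open>\<pi>\<^sub>\<delta>\<close> is continuous at \<open>0\<close>, so that the derivative of a long-run average for a fixed cost is the
  corresponding \<open>\<pi>\<^sub>0\<close>-mean (\<open>long_run_average_derivative\<close>). Finally the cost of the team variance depends
  on \<open>\<delta>\<close> through the team mean \<open>\<mu>\<^sub>\<delta>\<close>, but expanding the square around \<open>\<mu> = \<mu>\<^sub>0\<close> gives
  \<open>J(\<delta>) = (\<Sum>i. average of (r\<^sub>i - \<mu>)\<^sup>2 at \<delta>) - n (\<mu>\<^sub>\<delta> - \<mu>)\<^sup>2\<close>: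
  the moving mean contributes only a square of a differentiable function vanishing at \<open>0\<close>, whose
  derivative there is \<open>0\<close>. Near \<open>\<delta> = 0\<close>, in fact for all \<open>\<delta> < 1\<close>, the mixed chain has at
  least the transitions of the chain of \<open>u\<close> and therefore inherits the positivity of a power.
\<close>

section \<open>Ergodic finite chains have a strictly positive power\<close>

text \<open>
  The least positive difference \<open>d\<close> of two elements of \<open>M\<close> divides every element, since a nonzero
  remainder modulo \<open>d\<close> would be a smaller difference. So \<open>d = 1\<close> and \<open>M\<close> contains two consecutive
  numbers \<open>a\<close> and \<open>a + 1\<close>, whose combinations cover everything from \<open>a\<^sup>2\<close> on.
\<close>

lemma additively_closed_Gcd_1_cofinite:
  fixes M :: "nat set"
  assumes add: "\<And>a b. a \<in> M \<Longrightarrow> b \<in> M \<Longrightarrow> a + b \<in> M"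
    and pos: "0 \<notin> M" and gcd: "Gcd M = 1"
  shows "\<exists>N. \<forall>m\<ge>N. m \<in> M"
proof -
  have mult: "Suc k * a \<in> M" if "a \<in> M" for k a
    using that by (induction k) (auto intro: add)
  define D where "D = {d. 0 < d \<and> (\<exists>a\<in>M. a + d \<in> M)}"
  have "M \<noteq> {}" using gcd by auto
  then obtain a0 where "a0 \<in> M" by auto
  then have "a0 \<in> D" using pos add[of a0 a0] by (auto simp: D_def intro: gr0I)
  define d where "d = (LEAST d. d \<in> D)"
  have "d \<in> D" unfolding d_def using \<open>a0 \<in> D\<close> by (rule LeastI)
  then obtain a where a: "a \<in> M" "a + d \<in> M" and d: "0 < d" by (auto simp: D_def)
  have "d dvd b" if b: "b \<in> M" for b
  proof (rule ccontr)
    assume "\<not> d dvd b"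
    then have r: "0 < b mod d" by (simp add: mod_greater_zero_iff_not_dvd)
    define q where "q = b div d"
    have "a + q * (a + d) \<in> M"
      by (cases q) (use a mult[of "a + d"] add in auto)
    moreover have "a + q * (a + d) + b mod d = Suc q * a + b"
      by (simp add: q_def algebra_simps)
    moreover have "Suc q * a + b \<in> M"
      by (intro add mult a b)
    ultimately have "b mod d \<in> D"
      using r unfolding D_def by (intro CollectI conjI bexI[of _ "a + q * (a + d)"]) (simp_all only:)
    then have "d \<le> b mod d" unfolding d_def by (rule Least_le)
    with mod_less_divisor[OF d, of b] show False by simp
  qed
  then have "d dvd Gcd M" by (rule Gcd_greatest)
  then have a': "Suc a \<in> M" using a gcd by simp
  have "0 < a" using a pos by (auto intro: gr0I)
  have "m \<in> M" if m: "a * a \<le> m" for m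
  proof -
    have le: "m mod a < m div a"
      using mod_less_divisor[OF \<open>0 < a\<close>, of m] div_le_mono[OF m, of a] \<open>0 < a\<close>
      by (auto simp del: mod_less_divisor)
    then obtain k where k: "m div a = m mod a + Suc k"
      by (metis add_Suc_right less_imp_Suc_add)
    have "m = (m mod a + Suc k) * a + m mod a"
      unfolding k[symmetric] by simp
    then have eq: "m = Suc k * a + m mod a * Suc a"
      by (simp add: algebra_simps)
    show ?thesis
    proof (cases "m mod a")
      case 0
      then show ?thesis using eq mult[OF a(1), of k] by simp
    next
      case (Suc l)
      then show ?thesis
        using eq add[OF mult[OF a(1), of k] mult[OF a', of l]] by simp
    qed
  qed
  then show ?thesis by blast
qed

lemma n_step_add: "n_step K (k + l) x = bind_pmf (n_step K k x) (n_step K l)"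
  by (induction k arbitrary: x)
     (auto simp: bind_return_pmf bind_assoc_pmf intro!: bind_pmf_cong)

lemma set_n_step_trans:
  "y \<in> set_pmf (n_step K k x) \<Longrightarrow> z \<in> set_pmf (n_step K l y) \<Longrightarrow> z \<in> set_pmf (n_step K (k + l) x)"
  by (auto simp: n_step_add)

lemma n_step_Suc_right: "n_step K (Suc t) x = bind_pmf (n_step K t x) K"
proof -
  have "n_step K 0 = return_pmf" by (rule HOL.ext) simp
  then have "n_step K 1 = K" by (intro HOL.ext) (simp add: bind_return_pmf')
  then show ?thesis using n_step_add[of K t 1 x] by simp
qed

lemma set_n_step_closed:
  assumes "\<And>x. x \<in> Z \<Longrightarrow> set_pmf (K x) \<subseteq> Z" "x \<in> Z"
  shows "set_pmf (n_step K t x) \<subseteq> Z"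
  using assms(2)
proof (induction t arbitrary: x)
  case (Suc t)
  then show ?case using assms(1) by (auto simp: set_bind_pmf)
qed simp

text \<open>
  The return times to a state are closed under addition and, by aperiodicity, have gcd \<open>1\<close>, so the
  chain can return at every late enough time. One exponent then works for all pairs of states because
  there are finitely many.
\<close>

lemma ergodic_chain_primitive:
  assumes "finite S" "ergodic_chain S K"
  shows "\<exists>m. \<forall>x\<in>S. \<forall>y\<in>S. y \<in> set_pmf (n_step K m x)"
proof -
  have "\<forall>x\<in>S. \<exists>N. \<forall>m\<ge>N. x \<in> set_pmf (n_step K m x)"
  proof
    fix x assume "x \<in> S"
    define M where "M = {m. m > 0 \<and> x \<in> set_pmf (n_step K m x)}"
    have "Gcd M = 1"
      using assms(2) \<open>x \<in> S\<close>
      by (auto simp: ergodic_chain_def aperiodic_chain_def pmf_positive_iff M_def)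
    then have "\<exists>N. \<forall>m\<ge>N. m \<in> M"
      by (intro additively_closed_Gcd_1_cofinite) (auto simp: M_def intro: set_n_step_trans)
    then show "\<exists>N. \<forall>m\<ge>N. x \<in> set_pmf (n_step K m x)" by (auto simp: M_def)
  qed
  then obtain N where N: "\<And>x m. x \<in> S \<Longrightarrow> m \<ge> N x \<Longrightarrow> x \<in> set_pmf (n_step K m x)"
    by metis
  have "\<forall>x\<in>S. \<forall>y\<in>S. \<exists>m. y \<in> set_pmf (n_step K m x)"
    using assms(2) by (auto simp: ergodic_chain_def irreducible_chain_def pmf_positive_iff)
  then obtain k where k: "\<And>x y. x \<in> S \<Longrightarrow> y \<in> S \<Longrightarrow> y \<in> set_pmf (n_step K (k x y) x)"
    by metis
  define m where "m = (\<Sum>x\<in>S. \<Sum>y\<in>S. N x + k x y)"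
  have "y \<in> set_pmf (n_step K m x)" if xy: "x \<in> S" "y \<in> S" for x y
  proof -
    have "N x + k x y \<le> (\<Sum>y\<in>S. N x + k x y)"
      using xy assms(1) by (intro member_le_sum) auto
    also have "\<dots> \<le> m"
      unfolding m_def using xy assms(1)
      by (intro member_le_sum[where f="\<lambda>x. \<Sum>y\<in>S. N x + k x y"]) auto
    finally have "N x \<le> m - k x y" "m = (m - k x y) + k x y" by auto
    then show ?thesis using set_n_step_trans[OF N k] xy by metis
  qed
  then show ?thesis by blast
qed

section \<open>Finite chains with a strictly positive power\<close>

lemma integral_bind_pmf_finite:
  fixes f :: "'b \<Rightarrow> real"
  assumes "finite (set_pmf p)" "\<And>x. x \<in> set_pmf p \<Longrightarrow> finite (set_pmf (k x))"
  shows "(\<integral>y. f y \<partial>bind_pmf p k) = (\<integral>x. (\<integral>y. f y \<partial>k x) \<partial>p)"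
  using assms by (simp add: pmf_expectation_bind[of "set_pmf p"] integral_measure_pmf[of "set_pmf p"])

lemma integral_pmf_cong:
  fixes f g :: "'b \<Rightarrow> real"
  assumes "\<And>x. x \<in> set_pmf p \<Longrightarrow> f x = g x"
  shows "(\<integral>x. f x \<partial>p) = (\<integral>x. g x \<partial>p)"
  using assms by (intro integral_cong_AE) (auto simp: AE_measure_pmf_iff)

lemma integral_pmf_between:
  fixes f :: "'b \<Rightarrow> real"
  assumes "finite (set_pmf p)" "\<And>x. x \<in> set_pmf p \<Longrightarrow> a \<le> f x" "\<And>x. x \<in> set_pmf p \<Longrightarrow> f x \<le> b"
  shows "a \<le> (\<integral>x. f x \<partial>p)" "(\<integral>x. f x \<partial>p) \<le> b"
  using assms
  by (auto intro!: measure_pmf.integral_ge_const measure_pmf.integral_le_const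
      integrable_measure_pmf_finite simp: AE_measure_pmf_iff)

lemma integrable_pmf_bounded:
  fixes G :: "'x \<Rightarrow> real"
  assumes "\<And>x. \<bar>G x\<bar> \<le> B"
  shows "integrable (measure_pmf p) G"
  using assms by (intro measure_pmf.integrable_const_bound[of _ B]) auto

lemma integral_pmf_abs_le:
  fixes G :: "'x \<Rightarrow> real"
  assumes "\<And>x. \<bar>G x\<bar> \<le> B"
  shows "\<bar>\<integral>x. G x \<partial>measure_pmf p\<bar> \<le> B"
proof -
  have "- B \<le> G x" "G x \<le> B" for x using assms[of x] by auto
  then have "- B \<le> (\<integral>x. G x \<partial>measure_pmf p)" "(\<integral>x. G x \<partial>measure_pmf p) \<le> B"
    using integrable_pmf_bounded[of G, OF assms]
    by (auto intro!: measure_pmf.integral_ge_const measure_pmf.integral_le_const)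
  then show ?thesis by simp
qed

lemma integral_bind_pmf_bounded:
  fixes G :: "'y \<Rightarrow> real"
  assumes "\<And>x. \<bar>G x\<bar> \<le> B"
  shows "(\<integral>y. G y \<partial>bind_pmf p k) = (\<integral>x. (\<integral>y. G y \<partial>k x) \<partial>p)"
  unfolding measure_pmf_bind
proof (rule integral_bind[where B'=1 and B=B and K="count_space UNIV"])
  show "finite_measure (measure_pmf p)" by unfold_locales
qed (use assms in \<open>simp_all add: measure_pmf.emeasure_space_1 measure_pmf_in_subprob_algebra\<close>)

text \<open>
  Primitivity, rather than ergodicity, is the working hypothesis because it only depends on which
  transitions are possible and survives the addition of further transitions.
\<close>

locale primitive_chain =
  fixes S :: "'x set" and K :: "'x \<Rightarrow> 'x pmf"
  assumes fin: "finite S" and nonempty: "S \<noteq> {}"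
    and closed: "x \<in> S \<Longrightarrow> set_pmf (K x) \<subseteq> S"
    and primitive: "\<exists>m. \<forall>x\<in>S. \<forall>y\<in>S. y \<in> set_pmf (n_step K m x)"
begin

abbreviation P :: "nat \<Rightarrow> ('x \<Rightarrow> real) \<Rightarrow> 'x \<Rightarrow> real" where
  "P t f x \<equiv> (\<integral>y. f y \<partial>n_step K t x)"

lemma set_n_step: "x \<in> S \<Longrightarrow> set_pmf (n_step K t x) \<subseteq> S"
  using closed by (rule set_n_step_closed)

lemma finite_support: "set_pmf p \<subseteq> S \<Longrightarrow> finite (set_pmf p)"
  using fin by (rule finite_subset[rotated])

lemma integral_bind_S:
  fixes f :: "'x \<Rightarrow> real"
  assumes "set_pmf p \<subseteq> S" "\<And>x. x \<in> S \<Longrightarrow> set_pmf (k x) \<subseteq> S"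
  shows "(\<integral>y. f y \<partial>bind_pmf p k) = (\<integral>x. (\<integral>y. f y \<partial>k x) \<partial>p)"
  using assms by (intro integral_bind_pmf_finite) (auto intro!: finite_support)

lemma P_add: "x \<in> S \<Longrightarrow> P (k + l) f x = P k (P l f) x"
  by (simp add: n_step_add integral_bind_S set_n_step)

lemma P_Suc: "x \<in> S \<Longrightarrow> P (Suc t) f x = (\<integral>y. P t f y \<partial>K x)"
  by (simp add: integral_bind_S set_n_step closed)

lemma integral_S_between:
  fixes f :: "'x \<Rightarrow> real"
  assumes "set_pmf p \<subseteq> S" "\<And>x. x \<in> S \<Longrightarrow> a \<le> f x \<and> f x \<le> b"
  shows "a \<le> (\<integral>x. f x \<partial>p) \<and> (\<integral>x. f x \<partial>p) \<le> b"
proof -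
  have "a \<le> f x" "f x \<le> b" if "x \<in> set_pmf p" for x
    using assms that by auto
  then show ?thesis
    using integral_pmf_between[OF finite_support[OF assms(1)], of a f b] by blast
qed

lemma P_minorized:
  "\<exists>m>0. \<exists>\<epsilon>>0. \<epsilon> \<le> 1/2 \<and> (\<forall>x\<in>S. \<forall>y\<in>S. \<epsilon> \<le> pmf (n_step K m x) y)"
proof -
  obtain m where m: "\<And>x y. x \<in> S \<Longrightarrow> y \<in> S \<Longrightarrow> y \<in> set_pmf (n_step K m x)"
    using primitive by blast
  have m': "y \<in> set_pmf (n_step K (Suc m) x)" if "x \<in> S" "y \<in> S" for x y
    using m[OF _ that(2)] closed[OF that(1)] set_pmf_not_empty[of "K x"]
    by (auto simp: set_bind_pmf)
  define V where "V = (\<lambda>(x, y). pmf (n_step K (Suc m) x) y) ` (S \<times> S)"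
  have V: "finite V" "V \<noteq> {}" using fin nonempty by (auto simp: V_def)
  have "Min (insert (1/2) V) > 0"
    using V m' by (auto simp: V_def pmf_positive)
  moreover have "Min (insert (1/2) V) \<le> pmf (n_step K (Suc m) x) y" if "x \<in> S" "y \<in> S" for x y
    using V that by (intro Min_le) (auto simp: V_def)
  moreover have "Min (insert (1/2) V) \<le> 1/2"
    using V by (intro Min_le) auto
  ultimately show ?thesis by blast
qed

text \<open>
  Doeblin's argument: all the \<open>m\<close>-step distributions give mass at least \<open>\<epsilon>\<close> to a common state \<open>z\<close>,
  which pulls all the averages of \<open>g\<close> towards the value \<open>g z\<close> by the factor \<open>\<epsilon>\<close>.
\<close>

lemma P_contract:
  assumes min: "\<And>x y. x \<in> S \<Longrightarrow> y \<in> S \<Longrightarrow> \<epsilon> \<le> pmf (n_step K m x) y"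
    and g: "\<And>x. x \<in> S \<Longrightarrow> a \<le> g x \<and> g x \<le> a + D"
  shows "\<exists>a'. \<forall>x\<in>S. a' \<le> P m g x \<and> P m g x \<le> a' + (1 - \<epsilon>) * D"
proof -
  obtain z where z: "z \<in> S" using nonempty by auto
  have lower: "\<epsilon> * w z \<le> P m w x" if x: "x \<in> S" and w: "\<And>y. y \<in> S \<Longrightarrow> 0 \<le> w y" for x w
  proof -
    have "\<epsilon> * w z \<le> pmf (n_step K m x) z * w z"
      using min[OF x z] w[OF z] by (rule mult_right_mono)
    also have "\<dots> \<le> (\<Sum>y\<in>S. pmf (n_step K m x) y * w y)"
      using z w fin by (intro member_le_sum) auto
    also have "\<dots> = P m w x"
      using set_n_step[OF x, of m] fin by (subst integral_measure_pmf[of S]) auto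
    finally show ?thesis .
  qed
  have int: "integrable (n_step K m x) w" if "x \<in> S" for x and w :: "'x \<Rightarrow> real"
    using that by (intro integrable_measure_pmf_finite finite_support set_n_step)
  \<comment> \<open>The two bounds are the same estimate, applied to the distances of \<open>g\<close> from the two ends.\<close>
  have "a + \<epsilon> * (g z - a) \<le> P m g x \<and> P m g x \<le> a + \<epsilon> * (g z - a) + (1 - \<epsilon>) * D"
    if x: "x \<in> S" for x
    using lower[OF x, of "\<lambda>y. g y - a"] lower[OF x, of "\<lambda>y. a + D - g y"] g int[OF x]
    by (simp add: algebra_simps)
  then show ?thesis by blast
qed

text \<open>
  Every block of \<open>m\<close> steps contracts the range of the iterates by \<open>1 - \<epsilon> = \<rho>\<^sup>m\<close>. The range is
  described by an interval whose left end \<open>a\<close> may depend on \<open>t\<close>, as the limit is not yet known.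
\<close>

lemma P_oscillation:
  "\<exists>C \<rho>. 0 < \<rho> \<and> \<rho> < 1 \<and> (\<forall>t. \<exists>a. \<forall>x\<in>S. a \<le> P t f x \<and> P t f x \<le> a + C * \<rho> ^ t)"
proof -
  obtain m \<epsilon> where m: "0 < m" and \<epsilon>: "0 < \<epsilon>" "\<epsilon> \<le> 1/2"
    and min: "\<And>x y. x \<in> S \<Longrightarrow> y \<in> S \<Longrightarrow> \<epsilon> \<le> pmf (n_step K m x) y"
    using P_minorized by blast
  define \<rho> where "\<rho> = root m (1 - \<epsilon>)"
  have \<rho>: "0 < \<rho>" "\<rho> < 1" "\<rho> ^ m = 1 - \<epsilon>"
    using m \<epsilon> by (auto simp: \<rho>_def)
  define a D where "a = Min (f ` S)" and "D = Max (f ` S) - a"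
  have f: "a \<le> f x" "f x \<le> a + D" if "x \<in> S" for x
    using fin that by (auto simp: a_def D_def)
  have "0 \<le> D" using f nonempty by force
  \<comment> \<open>Dividing by \<open>\<rho> ^ m\<close> absorbs the first, incomplete block of fewer than \<open>m\<close> steps.\<close>
  define C where "C = D / \<rho> ^ m"
  have "\<exists>a. \<forall>x\<in>S. a \<le> P t f x \<and> P t f x \<le> a + C * \<rho> ^ t" for t
  proof (induction t rule: less_induct)
    case (less t)
    show ?case
    proof (cases "t < m")
      case True
      have "D = C * \<rho> ^ m" using \<rho>(1) by (simp add: C_def)
      also have "\<dots> \<le> C * \<rho> ^ t"
        using True \<rho>(1,2) \<open>0 \<le> D\<close> by (intro mult_left_mono power_decreasing) (auto simp: C_def)
      finally have D: "D \<le> C * \<rho> ^ t" .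
      have "a \<le> P t f x \<and> P t f x \<le> a + D" if x: "x \<in> S" for x
        using set_n_step[OF x, of t] f by (intro integral_S_between) auto
      with D show ?thesis by (intro exI[of _ a]) force
    next
      case False
      then have t: "t = m + (t - m)" by simp
      obtain b where b: "\<And>x. x \<in> S \<Longrightarrow> b \<le> P (t - m) f x \<and> P (t - m) f x \<le> b + C * \<rho> ^ (t - m)"
        using less[of "t - m"] m False by auto
      have "(1 - \<epsilon>) * (C * \<rho> ^ (t - m)) = C * (\<rho> ^ m * \<rho> ^ (t - m))"
        using \<rho>(3) by simp
      also have "\<dots> = C * \<rho> ^ t"
        using t by (simp flip: power_add)
      finally have *: "(1 - \<epsilon>) * (C * \<rho> ^ (t - m)) = C * \<rho> ^ t" .
      have "P t f x = P m (P (t - m) f) x" if "x \<in> S" for x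
        using P_add[OF that, of m "t - m" f] t by simp
      moreover obtain a' where "\<forall>x\<in>S. a' \<le> P m (P (t - m) f) x \<and> P m (P (t - m) f) x \<le> a' + C * \<rho> ^ t"
        using P_contract[where g="P (t - m) f", OF min b] unfolding * by blast
      ultimately show ?thesis by (intro exI[of _ a']) simp
    qed
  qed
  then show ?thesis using \<rho> by blast
qed

lemma integral_invariant:
  fixes f :: "'x \<Rightarrow> real"
  assumes "set_pmf \<pi> \<subseteq> S" "bind_pmf \<pi> K = \<pi>"
  shows "(\<integral>x. P t f x \<partial>\<pi>) = (\<integral>x. f x \<partial>\<pi>)"
proof -
  have "bind_pmf \<pi> (n_step K t) = \<pi>"
  proof (induction t)
    case 0
    then show ?case by (simp add: bind_return_pmf')
  next
    case (Suc t)
    have "bind_pmf \<pi> (n_step K (Suc t)) = bind_pmf (bind_pmf \<pi> K) (n_step K t)"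
      unfolding bind_assoc_pmf by (intro bind_pmf_cong) simp_all
    then show ?case by (simp only: assms(2) Suc)
  qed
  then show ?thesis
    using integral_bind_S[OF assms(1), of "n_step K t" f] set_n_step by simp
qed

lemma P_geometric:
  assumes "set_pmf \<pi> \<subseteq> S" "bind_pmf \<pi> K = \<pi>"
  shows "\<exists>C \<rho>. 0 < \<rho> \<and> \<rho> < 1 \<and> (\<forall>t. \<forall>x\<in>S. \<bar>P t f x - (\<integral>y. f y \<partial>\<pi>)\<bar> \<le> C * \<rho> ^ t)"
proof -
  obtain C \<rho> where \<rho>: "0 < \<rho>" "\<rho> < 1"
    and C: "\<And>t. \<exists>a. \<forall>x\<in>S. a \<le> P t f x \<and> P t f x \<le> a + C * \<rho> ^ t"
    using P_oscillation[of f] by blast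
  have "\<bar>P t f x - (\<integral>y. f y \<partial>\<pi>)\<bar> \<le> C * \<rho> ^ t" if x: "x \<in> S" for t x
  proof -
    obtain a where a: "\<And>x. x \<in> S \<Longrightarrow> a \<le> P t f x \<and> P t f x \<le> a + C * \<rho> ^ t"
      using C by blast
    have "a \<le> (\<integral>y. P t f y \<partial>\<pi>) \<and> (\<integral>y. P t f y \<partial>\<pi>) \<le> a + C * \<rho> ^ t"
      using assms(1) a by (rule integral_S_between)
    then show ?thesis
      using a[OF x] integral_invariant[OF assms, of t f] by auto
  qed
  then show ?thesis using \<rho> by blast
qed

lemma P_tendsto:
  assumes "set_pmf \<pi> \<subseteq> S" "bind_pmf \<pi> K = \<pi>" "x \<in> S"
  shows "(\<lambda>t. P t f x) \<longlonglongrightarrow> (\<integral>y. f y \<partial>\<pi>)"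
proof -
  obtain C \<rho> where \<rho>: "0 < \<rho>" "\<rho> < 1" 
    and C: "\<And>t x. x \<in> S \<Longrightarrow> \<bar>P t f x - (\<integral>y. f y \<partial>\<pi>)\<bar> \<le> C * \<rho> ^ t"
    using P_geometric[OF assms(1,2), of f] by blast
  have "(\<lambda>t. C * \<rho> ^ t) \<longlonglongrightarrow> C * 0"
    using \<rho> by (intro tendsto_mult tendsto_const LIMSEQ_power_zero) auto
  then have "(\<lambda>t. C * \<rho> ^ t) \<longlonglongrightarrow> 0" by simp
  moreover have "\<forall>\<^sub>F t in sequentially. norm (P t f x - (\<integral>y. f y \<partial>\<pi>)) \<le> C * \<rho> ^ t"
    using C[OF assms(3)] by (intro always_eventually) simp
  ultimately have "(\<lambda>t. P t f x - (\<integral>y. f y \<partial>\<pi>)) \<longlonglongrightarrow> 0"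
    by (rule Lim_null_comparison[rotated])
  then show ?thesis by (simp add: LIM_zero_iff)
qed

text \<open>
  A later iterate averages an earlier one, so it stays within the range of the latter. Unlike in
  \<open>P_tendsto\<close>, no stationary distribution is assumed: the limits are used to construct one.
\<close>

lemma P_convergent:
  assumes x: "x \<in> S"
  shows "convergent (\<lambda>t. P t f x)"
proof -
  obtain C \<rho> where \<rho>: "0 < \<rho>" "\<rho> < 1"
    and C: "\<And>t. \<exists>a. \<forall>x\<in>S. a \<le> P t f x \<and> P t f x \<le> a + C * \<rho> ^ t"
    using P_oscillation[of f] by blast
  have dist: "\<bar>P (t + k) f x - P t f x\<bar> \<le> C * \<rho> ^ t" for t k
  proof -
    obtain a where a: "\<And>x. x \<in> S \<Longrightarrow> a \<le> P t f x \<and> P t f x \<le> a + C * \<rho> ^ t"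
      using C by blast
    have "a \<le> P k (P t f) x \<and> P k (P t f) x \<le> a + C * \<rho> ^ t"
      using set_n_step[OF x] a by (rule integral_S_between)
    then show ?thesis
      using a[OF x] P_add[OF x, of k t f] by (auto simp: add.commute)
  qed
  have "(\<lambda>t. C * \<rho> ^ t) \<longlonglongrightarrow> C * 0"
    using \<rho> by (intro tendsto_mult tendsto_const LIMSEQ_power_zero) auto
  then have ev: "\<forall>e>0. \<exists>N. \<forall>t\<ge>N. \<bar>C * \<rho> ^ t\<bar> < e"
    by (simp add: LIMSEQ_iff)
  have "Cauchy (\<lambda>t. P t f x)"
  proof (rule CauchyI')
    fix e :: real assume "0 < e"
    then obtain N where N: "\<And>t. t \<ge> N \<Longrightarrow> \<bar>C * \<rho> ^ t\<bar> < e" using ev by blast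
    have "dist (P t f x) (P s f x) < e" if "N \<le> t" "t < s" for t s
      using dist[of t "s - t"] N[of t] that by (auto simp: dist_real_def abs_minus_commute)
    then show "\<exists>M. \<forall>m\<ge>M. \<forall>n>m. dist (P m f x) (P n f x) < e" by blast
  qed
  then show ?thesis by (rule Cauchy_convergent)
qed

text \<open>
  The limits of the \<open>t\<close>-step probabilities from any starting state form a stationary distribution;
  conversely \<open>P_tendsto\<close> forces every stationary distribution to consist of these limits.
\<close>

lemma ex1_stationary: "\<exists>!\<pi>. set_pmf \<pi> \<subseteq> S \<and> bind_pmf \<pi> K = \<pi>"
proof (rule ex_ex1I)
  fix \<pi> \<pi>' assume \<pi>: "set_pmf \<pi> \<subseteq> S \<and> bind_pmf \<pi> K = \<pi>" and \<pi>': "set_pmf \<pi>' \<subseteq> S \<and> bind_pmf \<pi>' K = \<pi>'"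
  obtain x where x: "x \<in> S" using nonempty by auto
  show "\<pi> = \<pi>'"
  proof (rule pmf_eqI)
    fix y
    have "(\<integral>z. indicator {y} z \<partial>\<pi>) = (\<integral>z. indicator {y} z \<partial>\<pi>' :: real)"
      using \<pi> \<pi>' x by (intro LIMSEQ_unique[OF P_tendsto P_tendsto]) auto
    then show "pmf \<pi> y = pmf \<pi>' y"
      by (simp add: measure_pmf_single)
  qed
next
  obtain x where x: "x \<in> S" using nonempty by auto
  have "convergent (\<lambda>t. pmf (n_step K t x) y)" for y
    using P_convergent[OF x, of "indicator {y}"] by (simp add: measure_pmf_single)
  then obtain q where q: "\<And>y. (\<lambda>t. pmf (n_step K t x) y) \<longlonglongrightarrow> q y"
    unfolding convergent_def by metis
  have q0: "0 \<le> q y" for y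
    using q[of y] by (rule LIMSEQ_le_const) auto
  have outside: "pmf (n_step K t x) y = 0" if "y \<notin> S" for t y
    using set_n_step[OF x, of t] that by (auto simp: set_pmf_iff)
  have qS: "q y = 0" if "y \<notin> S" for y
    using q[of y] that by (simp add: outside LIMSEQ_const_iff)
  have "(\<lambda>t. \<Sum>y\<in>S. pmf (n_step K t x) y) \<longlonglongrightarrow> (\<Sum>y\<in>S. q y)"
    by (intro tendsto_sum q)
  moreover have "(\<Sum>y\<in>S. pmf (n_step K t x) y) = 1" for t
    using fin set_n_step[OF x] by (rule sum_pmf_eq_1)
  ultimately have q1: "(\<Sum>y\<in>S. q y) = 1"
    by (simp add: LIMSEQ_const_iff)
  have "(\<integral>\<^sup>+y. ennreal (q y) \<partial>count_space UNIV) = (\<Sum>y\<in>S. ennreal (q y))"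
    using fin qS by (intro nn_integral_count_space') auto
  also have "\<dots> = 1" using q0 q1 by (simp add: sum_ennreal)
  finally have nn: "(\<integral>\<^sup>+y. ennreal (q y) \<partial>count_space UNIV) = 1" .
  define \<pi> where "\<pi> = embed_pmf q"
  have \<pi>: "pmf \<pi> y = q y" for y
    unfolding \<pi>_def using q0 nn by (rule pmf_embed_pmf)
  have sub: "set_pmf \<pi> \<subseteq> S" unfolding set_pmf_eq \<pi> using qS by blast
  have "pmf (bind_pmf \<pi> K) y = pmf \<pi> y" for y
  proof -
    have *: "pmf (bind_pmf p K) y = (\<Sum>z\<in>S. pmf p z * pmf (K z) y)" if "set_pmf p \<subseteq> S" for p
      unfolding pmf_bind using that fin by (subst integral_measure_pmf[of S]) auto
    have "(\<lambda>t. \<Sum>z\<in>S. pmf (n_step K t x) z * pmf (K z) y) \<longlonglongrightarrow> (\<Sum>z\<in>S. q z * pmf (K z) y)"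
      by (intro tendsto_sum tendsto_mult q tendsto_const)
    moreover have "(\<Sum>z\<in>S. pmf (n_step K t x) z * pmf (K z) y) = pmf (n_step K (Suc t) x) y" for t
      by (simp only: *[OF set_n_step[OF x]] n_step_Suc_right)
    ultimately have "(\<Sum>z\<in>S. q z * pmf (K z) y) = q y"
      using LIMSEQ_Suc[OF q[of y]] by (intro LIMSEQ_unique) auto
    then show ?thesis by (simp add: *[OF sub] \<pi>)
  qed
  then show "\<exists>\<pi>. set_pmf \<pi> \<subseteq> S \<and> bind_pmf \<pi> K = \<pi>"
    using sub by (intro exI[of _ \<pi>]) (auto intro: pmf_eqI)
qed

abbreviation stat :: "'x pmf" where "stat \<equiv> stationary_dist S K"

lemma stationary: "set_pmf stat \<subseteq> S" "bind_pmf stat K = stat"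
  using theI'[OF ex1_stationary] unfolding stationary_dist_def by auto

text \<open>
  The partial sums are part of the statement, because the performance potential is defined as their
  limit. Applying \<open>K\<close> to the series drops its first term \<open>f x - c\<close>.
\<close>

lemma poisson_equation:
  "\<exists>h. \<forall>x\<in>S. (\<lambda>T. \<Sum>t<T. P t f x - (\<integral>y. f y \<partial>stat)) \<longlonglongrightarrow> h x \<and>
        f x - (\<integral>y. f y \<partial>stat) = h x - (\<integral>y. h y \<partial>K x)"
proof -
  define c where "c = (\<integral>y. f y \<partial>stat)"
  obtain C \<rho> where \<rho>: "0 < \<rho>" "\<rho> < 1"
    and C: "\<And>t x. x \<in> S \<Longrightarrow> \<bar>P t f x - c\<bar> \<le> C * \<rho> ^ t"
    using P_geometric[OF stationary, of f] unfolding c_def by blast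
  have sm: "summable (\<lambda>t. P t f x - c)" if "x \<in> S" for x
  proof (rule summable_comparison_test')
    show "summable (\<lambda>t. C * \<rho> ^ t)"
      using \<rho> by (intro summable_mult summable_geometric) simp
    show "norm (P t f x - c) \<le> C * \<rho> ^ t" if "0 \<le> t" for t
      using C[OF \<open>x \<in> S\<close>, of t] by simp
  qed
  define h where "h x = (\<Sum>t. P t f x - c)" for x
  have "f x - c = h x - (\<integral>y. h y \<partial>K x)" if x: "x \<in> S" for x
  proof -
    have Kx: "(\<integral>y. w y \<partial>K x) = (\<Sum>y\<in>S. pmf (K x) y * w y)" for w :: "'x \<Rightarrow> real"
      using closed[OF x] fin by (subst integral_measure_pmf[of S]) auto
    have "(\<integral>y. h y \<partial>K x) = (\<Sum>t. \<Sum>y\<in>S. pmf (K x) y * (P t f y - c))"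
    proof -
      have "(\<Sum>t. \<Sum>y\<in>S. pmf (K x) y * (P t f y - c)) = (\<Sum>y\<in>S. \<Sum>t. pmf (K x) y * (P t f y - c))"
        by (rule suminf_sum) (rule summable_mult[OF sm])
      also have "\<dots> = (\<Sum>y\<in>S. pmf (K x) y * h y)"
        unfolding h_def by (intro sum.cong refl suminf_mult sm)
      finally show ?thesis unfolding Kx by simp
    qed
    also have "\<dots> = (\<Sum>t. P (Suc t) f x - c)"
    proof (intro arg_cong[of _ _ suminf] HOL.ext)
      fix t
      have "(\<Sum>y\<in>S. pmf (K x) y * (P t f y - c)) = (\<integral>y. P t f y - c \<partial>K x)"
        by (rule Kx[symmetric])
      also have "\<dots> = (\<integral>y. P t f y \<partial>K x) - c"
        by (simp add: integrable_measure_pmf_finite[OF finite_support[OF closed[OF x]]])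
      finally show "(\<Sum>y\<in>S. pmf (K x) y * (P t f y - c)) = P (Suc t) f x - c"
        using P_Suc[OF x, of t f] by (simp only:)
    qed
    also have "\<dots> = h x - (P 0 f x - c)"
      using suminf_split_head[OF sm[OF x]] by (simp add: h_def)
    finally show ?thesis by simp
  qed
  moreover have "(\<lambda>T. \<Sum>t<T. P t f x - c) \<longlonglongrightarrow> h x" if "x \<in> S" for x
    using summable_LIMSEQ[OF sm[OF that]] by (simp add: h_def)
  ultimately show ?thesis unfolding c_def by blast
qed

end

section \<open>The Markov property and the ergodic theorem on trajectory space\<close>

abbreviation path_algebra :: "nat set \<Rightarrow> (nat \<Rightarrow> 'x) measure" where
  "path_algebra J \<equiv> PiM J (\<lambda>_. count_space UNIV)"

lemma measurable_coordinate:
  fixes G :: "'x \<Rightarrow> real"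
  assumes "t \<in> J"
  shows "(\<lambda>\<omega>. G (\<omega> t)) \<in> borel_measurable (path_algebra J)"
  by (rule measurable_compose[OF measurable_component_singleton[OF assms], where g=G]) simp

lemma measurable_markov_law:
  "f \<in> measurable (markov_law \<nu> K) N \<longleftrightarrow> f \<in> measurable (path_algebra UNIV) N"
  by (simp add: measurable_cong_sets[OF sets_markov_law refl])

lemma measurable_markov_law_coordinate:
  fixes G :: "'x \<Rightarrow> real"
  shows "(\<lambda>\<omega>. G (\<omega> t)) \<in> borel_measurable (markov_law \<nu> K)"
  by (simp add: measurable_markov_law measurable_coordinate)

text \<open>
  The last of the first \<open>t + 1\<close> coordinates can be integrated out with the kernel, as the law of the
  prefix of a trajectory is built by appending coordinates one at a time.
\<close>

lemma markov_law_prefix: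
  fixes K :: "'x \<Rightarrow> 'x pmf"
  assumes f: "f \<in> borel_measurable (path_algebra {0..<Suc t})" and B: "\<And>y. \<bar>f y\<bar> \<le> (B::real)"
  shows "(\<integral>\<omega>. f (restrict \<omega> {0..<Suc t}) \<partial>markov_law \<nu> K) =
    (\<integral>\<omega>. (\<integral>x. f ((restrict \<omega> {0..<t})(t := x)) \<partial>markov_kernels \<nu> K t \<omega>) \<partial>markov_law \<nu> K)"
proof -
  let ?M = "\<lambda>_::nat. count_space (UNIV :: 'x set)"
  interpret Ionescu_Tulcea "markov_kernels \<nu> K" ?M
    by (rule Ionescu_Tulcea_markov)
  have lim: "distr (markov_law \<nu> K) (PiM {0..<n} ?M) (\<lambda>\<omega>. restrict \<omega> {0..<n}) = C 0 n (\<lambda>_. undefined)" for n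
  proof -
    have "distr (markov_law \<nu> K) (PiM {0..<n} ?M) (\<lambda>\<omega>. restrict \<omega> {0..<n}) = CI {0..<n}"
      unfolding markov_law_def by (rule distr_lim) simp
    also have "\<dots> = C 0 n (\<lambda>_. undefined)"
    proof (rule measure_eqI)
      show "sets (CI {0..<n}) = sets (C 0 n (\<lambda>_. undefined))"
        by (simp add: CI_def sets_C space_PiM)
      fix X assume "X \<in> sets (CI {0..<n})"
      then have X: "X \<in> sets (PiM {0..<n} ?M)" by (simp add: CI_def)
      then have "PF.emb {0..<n} {0..<n} X = X"
        using sets.sets_into_space[OF X] by (intro prod_emb_id) (simp add: space_PiM)
      then show "emeasure (CI {0..<n}) X = emeasure (C 0 n (\<lambda>_. undefined)) X"
        using emeasure_CI[OF subset_refl X] by simp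
    qed
    finally show ?thesis .
  qed
  have past: "markov_kernels \<nu> K t (restrict \<omega> {0..<t}) = markov_kernels \<nu> K t \<omega>" for \<omega>
    by (cases t) (simp_all add: markov_kernels_def)
  have restr: "(\<lambda>\<omega>. restrict \<omega> {0..<n}) \<in> measurable (markov_law \<nu> K) (PiM {0..<n} ?M)" for n
    unfolding measurable_markov_law by (rule measurable_restrict_subset) simp
  have undef: "(\<lambda>_. undefined) \<in> space (PiM {0..<0} ?M)" by (simp add: space_PiM)
  note sets = sets_C[OF undef, simplified] and space = space_C[OF undef, simplified]
  have eP: "(\<integral>x. f x \<partial>eP t y) = (\<integral>x. f (y(t := x)) \<partial>markov_kernels \<nu> K t y)"
    if y: "y \<in> space (PiM {0..<t} ?M)" for y
  proof -
    have "fun_upd y t \<in> measurable (markov_kernels \<nu> K t y) (PiM {0..<Suc t} ?M)"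
      unfolding measurable_cong_sets[OF sets_P[OF y] refl]
      using y by (intro measurable_fun_upd[where J="{0..<t}"]) (auto simp: space_PiM)
    then show ?thesis
      unfolding eP_def by (rule integral_distr) (rule f)
  qed
  have "(\<integral>\<omega>. f (restrict \<omega> {0..<Suc t}) \<partial>markov_law \<nu> K) = (\<integral>y. f y \<partial>C 0 (Suc t) (\<lambda>_. undefined))"
    unfolding lim[symmetric] by (rule integral_distr[symmetric, OF restr f])
  also have "\<dots> = (\<integral>y. (\<integral>x. f x \<partial>eP t y) \<partial>C 0 t (\<lambda>_. undefined))"
    unfolding C.simps add_0
  proof (rule integral_bind[OF f B])
    show "eP t \<in> measurable (C 0 t (\<lambda>_. undefined)) (subprob_algebra (PiM {0..<Suc t} ?M))"
      unfolding measurable_cong_sets[OF sets refl] by (rule measurable_eP)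
    interpret prob_space "C 0 t (\<lambda>_. undefined)" by (rule prob_space_C[OF undef])
    show "finite_measure (C 0 t (\<lambda>_. undefined))" by unfold_locales
    show "AE x in C 0 t (\<lambda>_. undefined). emeasure (eP t x) (space (eP t x)) \<le> ennreal 1"
      by (intro AE_I2) (simp add: space prob_space.emeasure_space_1[OF prob_space_eP])
  qed
  also have "\<dots> = (\<integral>y. (\<integral>x. f (y(t := x)) \<partial>markov_kernels \<nu> K t y) \<partial>C 0 t (\<lambda>_. undefined))"
    by (intro Bochner_Integration.integral_cong refl eP) (simp add: space)
  also have "\<dots> = (\<integral>\<omega>. (\<integral>x. f ((restrict \<omega> {0..<t})(t := x))
      \<partial>markov_kernels \<nu> K t (restrict \<omega> {0..<t})) \<partial>markov_law \<nu> K)"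
    unfolding lim[symmetric]
  proof (rule integral_distr[OF restr])
    have "(\<lambda>y. (\<integral>x. f x \<partial>eP t y)) \<in> borel_measurable (PiM {0..<t} ?M)"
      by (rule measurable_compose[OF measurable_eP integral_measurable_subprob_algebra[OF f]])
    then show "(\<lambda>y. (\<integral>x. f (y(t := x)) \<partial>markov_kernels \<nu> K t y)) \<in> borel_measurable (PiM {0..<t} ?M)"
      using eP by (simp cong: measurable_cong)
  qed
  finally show ?thesis
    unfolding past .
qed


lemma markov_law_initial:
  fixes G :: "'x \<Rightarrow> real"
  assumes "\<And>x. \<bar>G x\<bar> \<le> B"
  shows "(\<integral>\<omega>. G (\<omega> 0) \<partial>markov_law \<nu> K) = (\<integral>x. G x \<partial>\<nu>)"
proof -
  interpret prob_space "markov_law \<nu> K" by (rule prob_space_markov_law)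
  show ?thesis
    using markov_law_prefix[of "\<lambda>y. G (y 0)" 0 B \<nu> K] assms prob_space
    by (simp add: markov_kernels_def measurable_coordinate)
qed

lemma markov_property:
  fixes X :: "(nat \<Rightarrow> 'x) \<Rightarrow> real" and G :: "'x \<Rightarrow> real"
  assumes X: "X \<in> borel_measurable (path_algebra {0..<Suc t})" "\<And>\<omega>. \<bar>X \<omega>\<bar> \<le> B"
    and past: "\<And>\<omega>. X (restrict \<omega> {0..<Suc t}) = X \<omega>"
    and G: "\<And>x. \<bar>G x\<bar> \<le> C"
  shows "(\<integral>\<omega>. X \<omega> * G (\<omega> (Suc t)) \<partial>markov_law \<nu> K) =
    (\<integral>\<omega>. X \<omega> * (\<integral>x. G x \<partial>K (\<omega> t)) \<partial>markov_law \<nu> K)"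
proof -
  let ?f = "\<lambda>y. X (restrict y {0..<Suc t}) * G (y (Suc t))"
  have "(\<lambda>y. X (restrict y {0..<Suc t})) \<in> borel_measurable (path_algebra {0..<Suc (Suc t)})"
    using measurable_compose[OF measurable_restrict_subset X(1)] by simp
  then have f: "?f \<in> borel_measurable (path_algebra {0..<Suc (Suc t)})"
    by (intro borel_measurable_times measurable_coordinate) simp_all
  have B: "\<bar>?f y\<bar> \<le> B * C" for y
    unfolding abs_mult using X(2)[of "restrict y {0..<Suc t}"] G[of "y (Suc t)"]
    by (intro mult_mono) auto
  have upd: "restrict ((restrict \<omega> {0..<Suc t})(Suc t := x)) {0..<Suc t} = restrict \<omega> {0..<Suc t}"
    for \<omega> :: "nat \<Rightarrow> 'x" and x
    by (auto simp: restrict_def)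
  have res: "restrict (restrict \<omega> {0..<Suc (Suc t)}) {0..<Suc t} = restrict \<omega> {0..<Suc t}"
    for \<omega> :: "nat \<Rightarrow> 'x"
    by (auto simp: restrict_def)
  show ?thesis
    using markov_law_prefix[OF f B, of \<nu> K] unfolding upd res past
    by (simp add: markov_kernels_def)
qed

lemma markov_law_marginal:
  fixes G :: "'x \<Rightarrow> real"
  assumes "\<And>x. \<bar>G x\<bar> \<le> B"
  shows "(\<integral>\<omega>. G (\<omega> t) \<partial>markov_law \<nu> K) = (\<integral>x. G x \<partial>bind_pmf \<nu> (n_step K t))"
  using assms
proof (induction t arbitrary: G)
  case 0
  have "n_step K 0 = return_pmf" by (rule HOL.ext) simp
  then show ?case using markov_law_initial[OF 0] by (simp add: bind_return_pmf')
next
  case (Suc t)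
  have "(\<integral>\<omega>. G (\<omega> (Suc t)) \<partial>markov_law \<nu> K) = (\<integral>\<omega>. (\<integral>x. G x \<partial>K (\<omega> t)) \<partial>markov_law \<nu> K)"
    using markov_property[of "\<lambda>_. 1" t 1 G B \<nu> K] Suc.prems by simp
  also have "\<dots> = (\<integral>x. (\<integral>y. G y \<partial>K x) \<partial>bind_pmf \<nu> (n_step K t))"
    by (intro Suc.IH integral_pmf_abs_le Suc.prems)
  also have "\<dots> = (\<integral>x. G x \<partial>bind_pmf (bind_pmf \<nu> (n_step K t)) K)"
    by (rule integral_bind_pmf_bounded[symmetric, OF Suc.prems])
  also have "bind_pmf (bind_pmf \<nu> (n_step K t)) K = bind_pmf \<nu> (n_step K (Suc t))"
    unfolding bind_assoc_pmf n_step_Suc_right[symmetric] ..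
  finally show ?case .
qed

lemma markov_law_AE_closed:
  assumes "set_pmf \<nu> \<subseteq> Z" "\<And>x. x \<in> Z \<Longrightarrow> set_pmf (K x) \<subseteq> Z"
  shows "AE \<omega> in markov_law \<nu> K. \<forall>t. \<omega> t \<in> Z"
  unfolding AE_all_countable
proof
  fix t
  interpret prob_space "markov_law \<nu> K" by (rule prob_space_markov_law)
  have "(\<integral>\<omega>. indicator (- Z) (\<omega> t) \<partial>markov_law \<nu> K) = (\<integral>x. indicator (- Z) x \<partial>bind_pmf \<nu> (n_step K t) :: real)"
    by (rule markov_law_marginal[of _ 1]) (simp add: indicator_def)
  also have "\<dots> = (\<integral>x. 0 \<partial>bind_pmf \<nu> (n_step K t) :: real)"
  proof (rule integral_pmf_cong)
    fix x assume "x \<in> set_pmf (bind_pmf \<nu> (n_step K t))"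
    then have "x \<in> Z"
      using assms set_n_step_closed[of Z K _ t, OF assms(2)] unfolding set_bind_pmf by blast
    then show "indicator (- Z) x = (0 :: real)" by simp
  qed
  finally have "(\<integral>\<omega>. indicator (- Z) (\<omega> t) \<partial>markov_law \<nu> K) = (0 :: real)" by simp
  moreover have "integrable (markov_law \<nu> K) (\<lambda>\<omega>. indicator (- Z) (\<omega> t) :: real)"
    by (intro integrable_const_bound[of _ 1] AE_I2 measurable_markov_law_coordinate)
       (simp add: indicator_def)
  ultimately have "AE \<omega> in markov_law \<nu> K. indicator (- Z) (\<omega> t) = (0 :: real)"
    by (subst (asm) integral_nonneg_eq_0_iff_AE) auto
  then show "AE \<omega> in markov_law \<nu> K. \<omega> t \<in> Z"
    by eventually_elim (simp add: indicator_def split: if_splits)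
qed


lemma filterlim_floor_sqrt: "filterlim floor_sqrt at_top sequentially"
  unfolding filterlim_at_top eventually_sequentially by (meson le_floor_sqrtI order_refl le_floor_sqrt_iff order_trans)

text \<open>
  Between \<open>k\<^sup>2\<close> and \<open>(k + 1)\<^sup>2\<close> there are only \<open>2 k\<close> further terms, negligible against \<open>k\<^sup>2\<close>.
\<close>

lemma average_tendsto_zero_from_squares:
  fixes d :: "nat \<Rightarrow> real"
  assumes d: "\<And>t. \<bar>d t\<bar> \<le> C"
    and sq: "(\<lambda>k. (\<Sum>t<k\<^sup>2. d t) / real (k\<^sup>2)) \<longlonglongrightarrow> 0"
  shows "(\<lambda>T. (\<Sum>t<T. d t) / real T) \<longlonglongrightarrow> 0"
proof -
  have C: "0 \<le> C" using d[of 0] by simp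
  define b where "b k = \<bar>(\<Sum>t<k\<^sup>2. d t) / real (k\<^sup>2)\<bar> + 2 * C / real k" for k
  have "b \<longlonglongrightarrow> \<bar>0\<bar> + 0"
    unfolding b_def by (intro tendsto_add tendsto_rabs sq lim_const_over_n)
  then have "(\<lambda>T. b (floor_sqrt T)) \<longlonglongrightarrow> 0"
    using filterlim_compose[OF _ filterlim_floor_sqrt, of b "nhds 0"] by simp
  moreover have "\<forall>\<^sub>F T in sequentially. norm ((\<Sum>t<T. d t) / real T) \<le> b (floor_sqrt T)"
    using eventually_gt_at_top[of 0]
  proof eventually_elim
    fix T :: nat assume "0 < T"
    define k where "k = floor_sqrt T"
    have k: "0 < k" "k\<^sup>2 \<le> T" "T \<le> k\<^sup>2 + 2 * k"
      using \<open>0 < T\<close> floor_sqrt_power2_le[of T] Suc_floor_sqrt_power2_gt[of T]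
      unfolding k_def power2_eq_square by auto
    have "(\<Sum>t<T. d t) = (\<Sum>t<k\<^sup>2. d t) + (\<Sum>t\<in>{k\<^sup>2..<T}. d t)"
      using sum.atLeastLessThan_concat[of 0 "k\<^sup>2" T d] k by (simp add: lessThan_atLeast0)
    moreover have "\<bar>\<Sum>t\<in>{k\<^sup>2..<T}. d t\<bar> \<le> (\<Sum>t\<in>{k\<^sup>2..<T}. C)"
      by (rule order_trans[OF sum_abs]) (intro sum_mono d)
    moreover have "(\<Sum>t\<in>{k\<^sup>2..<T}. C) \<le> real (2 * k) * C"
    proof -
      have "T - k\<^sup>2 \<le> 2 * k" using k(3) by linarith
      then have "real (T - k\<^sup>2) * C \<le> real (2 * k) * C"
        using C by (intro mult_right_mono of_nat_mono)
      then show ?thesis by (simp only: sum_constant card_atLeastLessThan)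
    qed
    ultimately have "\<bar>\<Sum>t<T. d t\<bar> \<le> \<bar>\<Sum>t<k\<^sup>2. d t\<bar> + real (2 * k) * C"
      by linarith
    moreover have "real (k\<^sup>2) \<le> real T" using k by (simp del: of_nat_power)
    ultimately have "\<bar>\<Sum>t<T. d t\<bar> / real T \<le> (\<bar>\<Sum>t<k\<^sup>2. d t\<bar> + real (2 * k) * C) / real (k\<^sup>2)"
      using k by (intro frac_le) auto
    also have "\<dots> = b k"
      using k by (simp add: b_def field_simps power2_eq_square)
    finally show "norm ((\<Sum>t<T. d t) / real T) \<le> b (floor_sqrt T)"
      by (simp add: k_def)
  qed
  ultimately show ?thesis by (rule Lim_null_comparison[rotated])
qed

text \<open>
  A strong law of large numbers for bounded martingale increments. Orthogonality makes the second
  moment of the \<open>T\<close>-th partial sum linear in \<open>T\<close>, so that the second moments of the averages are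
  summable along the squares \<open>T = k\<^sup>2\<close>; there the averages converge almost surely without appeal to a
  maximal inequality.
\<close>

lemma (in prob_space) orthogonal_partial_sums_average:
  fixes D :: "nat \<Rightarrow> 'a \<Rightarrow> real"
  assumes meas: "\<And>t. D t \<in> borel_measurable M"
    and bound: "\<And>t \<omega>. \<bar>D t \<omega>\<bar> \<le> C"
    and orth: "\<And>T. expectation (\<lambda>\<omega>. (\<Sum>t<T. D t \<omega>) * D T \<omega>) = 0"
  shows "AE \<omega> in M. (\<lambda>T. (\<Sum>t<T. D t \<omega>) / real T) \<longlonglongrightarrow> 0"
proof -
  note [measurable] = meas
  define S where "S T \<omega> = (\<Sum>t<T. D t \<omega>)" for T \<omega>
  have [measurable]: "S T \<in> borel_measurable M" for T unfolding S_def by measurable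
  have SB: "\<bar>S T \<omega>\<bar> \<le> real T * C" for T \<omega>
  proof -
    have "\<bar>S T \<omega>\<bar> \<le> (\<Sum>t<T. C)"
      unfolding S_def by (rule order_trans[OF sum_abs]) (intro sum_mono bound)
    then show ?thesis by simp
  qed
  have C: "0 \<le> C" using bound[of 0] by (meson abs_ge_zero order_trans)
  have prod_int: "integrable M (\<lambda>\<omega>. X \<omega> * Y \<omega>)"
    if [measurable]: "X \<in> borel_measurable M" "Y \<in> borel_measurable M"
      and "\<And>\<omega>. \<bar>X \<omega>\<bar> \<le> a" "\<And>\<omega>. \<bar>Y \<omega>\<bar> \<le> b" "0 \<le> a" for X Y and a b :: real
  proof (rule integrable_const_bound)
    show "AE \<omega> in M. norm (X \<omega> * Y \<omega>) \<le> a * b"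
      using that(3-5) by (intro AE_I2) (auto simp: abs_mult intro!: mult_mono)
  qed measurable
  have int: "integrable M (\<lambda>\<omega>. S T \<omega> * S T \<omega>)" "integrable M (\<lambda>\<omega>. S T \<omega> * D T \<omega>)"
    "integrable M (\<lambda>\<omega>. D T \<omega> * D T \<omega>)" for T
    using C by (auto intro!: prod_int SB bound meas)
  have second_moment: "expectation (\<lambda>\<omega>. S T \<omega> * S T \<omega>) \<le> real T * C\<^sup>2" for T
  proof (induction T)
    case 0
    then show ?case by (simp add: S_def)
  next
    case (Suc T)
    have "expectation (\<lambda>\<omega>. S (Suc T) \<omega> * S (Suc T) \<omega>) =
        expectation (\<lambda>\<omega>. S T \<omega> * S T \<omega> + 2 * (S T \<omega> * D T \<omega>) + D T \<omega> * D T \<omega>)"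
      by (simp add: S_def algebra_simps)
    also have "\<dots> = expectation (\<lambda>\<omega>. S T \<omega> * S T \<omega>) + expectation (\<lambda>\<omega>. D T \<omega> * D T \<omega>)"
      using int orth[of T] by (simp add: S_def)
    also have "expectation (\<lambda>\<omega>. D T \<omega> * D T \<omega>) \<le> C\<^sup>2"
    proof (rule integral_le_const[OF int(3)], rule AE_I2)
      fix \<omega> show "D T \<omega> * D T \<omega> \<le> C\<^sup>2"
        using power_mono[OF bound[of T \<omega>] abs_ge_zero, of 2] unfolding power2_abs
        by (simp add: power2_eq_square)
    qed
    finally show ?case using Suc by (simp add: algebra_simps)
  qed
  define Y where "Y k \<omega> = (S (k\<^sup>2) \<omega> / real (k\<^sup>2))\<^sup>2" for k \<omega>
  have [measurable]: "Y k \<in> borel_measurable M" for k unfolding Y_def by measurable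
  have Y0: "0 \<le> Y k \<omega>" for k \<omega> by (simp add: Y_def)
  have EY: "(\<integral>\<^sup>+\<omega>. ennreal (Y k \<omega>) \<partial>M) \<le> ennreal (C\<^sup>2 / real k ^ 2)" for k
  proof -
    have Y: "Y k = (\<lambda>\<omega>. S (k\<^sup>2) \<omega> * S (k\<^sup>2) \<omega> / (real (k\<^sup>2))\<^sup>2)"
      by (simp add: Y_def[abs_def] power_divide power2_eq_square)
    have "integrable M (Y k)" unfolding Y using int(1) by simp
    then have "(\<integral>\<^sup>+\<omega>. ennreal (Y k \<omega>) \<partial>M) = ennreal (expectation (Y k))"
      using Y0 by (intro nn_integral_eq_integral) auto
    also have "expectation (Y k) \<le> (real (k\<^sup>2) * C\<^sup>2) / (real (k\<^sup>2))\<^sup>2"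
      unfolding Y using second_moment[of "k\<^sup>2"] by (simp add: divide_right_mono)
    also have "\<dots> = C\<^sup>2 / real k ^ 2"
      by (simp add: power2_eq_square)
    finally show ?thesis by (simp add: ennreal_leI)
  qed
  have sm: "summable (\<lambda>k. C\<^sup>2 / real k ^ 2)"
    using summable_mult[OF inverse_power_summable[of 2], of "C\<^sup>2"] by (simp add: field_simps)
  have "(\<integral>\<^sup>+\<omega>. (\<Sum>k. ennreal (Y k \<omega>)) \<partial>M) = (\<Sum>k. \<integral>\<^sup>+\<omega>. ennreal (Y k \<omega>) \<partial>M)"
    by (rule nn_integral_suminf) simp
  also have "\<dots> \<le> (\<Sum>k. ennreal (C\<^sup>2 / real k ^ 2))"
    by (intro suminf_le EY summableI)
  also have "\<dots> = ennreal (\<Sum>k. C\<^sup>2 / real k ^ 2)"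
    by (rule suminf_ennreal2[OF _ sm]) simp
  finally have "(\<integral>\<^sup>+\<omega>. (\<Sum>k. ennreal (Y k \<omega>)) \<partial>M) \<noteq> \<infinity>"
    using ennreal_less_top order_le_less_trans by (metis infinity_ennreal_def less_irrefl)
  then have "AE \<omega> in M. (\<Sum>k. ennreal (Y k \<omega>)) \<noteq> \<infinity>"
    by (intro nn_integral_PInf_AE) simp
  then show ?thesis
  proof eventually_elim
    fix \<omega> assume "(\<Sum>k. ennreal (Y k \<omega>)) \<noteq> \<infinity>"
    then have "summable (\<lambda>k. Y k \<omega>)"
      using Y0 by (intro summable_suminf_not_top) auto
    then have "(\<lambda>k. sqrt (Y k \<omega>)) \<longlonglongrightarrow> sqrt 0"
      by (intro tendsto_real_sqrt summable_LIMSEQ_zero)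
    then have "(\<lambda>k. \<bar>S (k\<^sup>2) \<omega> / real (k\<^sup>2)\<bar>) \<longlonglongrightarrow> 0"
      by (simp only: Y_def real_sqrt_abs real_sqrt_zero)
    then have "(\<lambda>k. (\<Sum>t<k\<^sup>2. D t \<omega>) / real (k\<^sup>2)) \<longlonglongrightarrow> 0"
      unfolding S_def by (simp only: tendsto_rabs_zero_iff)
    then show "(\<lambda>T. (\<Sum>t<T. D t \<omega>) / real T) \<longlonglongrightarrow> 0"
      using bound by (intro average_tendsto_zero_from_squares)
  qed
qed

text \<open>
  The state space may be infinite: a bounded solution \<open>h\<close> of the Poisson equation on a closed set \<open>Z\<close>
  replaces any ergodicity hypothesis. By that equation the partial sums of \<open>F - c\<close> telescope up
  to the martingale with increments \<open>D t\<close>.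
\<close>

theorem markov_law_ergodic:
  fixes h F :: "'x \<Rightarrow> real"
  assumes \<nu>: "set_pmf \<nu> \<subseteq> Z" and Z: "\<And>x. x \<in> Z \<Longrightarrow> set_pmf (K x) \<subseteq> Z"
    and h: "\<And>x. x \<in> Z \<Longrightarrow> \<bar>h x\<bar> \<le> B"
    and poisson: "\<And>x. x \<in> Z \<Longrightarrow> F x - c = h x - (\<integral>y. h y \<partial>K x)"
  shows "AE \<omega> in markov_law \<nu> K. (\<lambda>T. 1 / real T * (\<Sum>t<T. F (\<omega> t))) \<longlonglongrightarrow> c"
proof -
  interpret prob_space "markov_law \<nu> K" by (rule prob_space_markov_law)
  \<comment> \<open>Outside \<open>Z\<close> nothing bounds \<open>h\<close>, but almost no trajectory leaves \<open>Z\<close>.\<close>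
  define g where "g x = (if x \<in> Z then h x else 0)" for x
  have "0 \<le> B"
    using h set_pmf_not_empty[of \<nu>] \<nu> by (meson abs_ge_zero all_not_in_conv order_trans subsetD)
  then have g: "\<bar>g x\<bar> \<le> B" for x using h by (simp add: g_def)
  define D where "D t \<omega> = g (\<omega> (Suc t)) - (\<integral>y. g y \<partial>K (\<omega> t))" for t and \<omega> :: "nat \<Rightarrow> 'x"
  have Kg: "\<bar>\<integral>y. g y \<partial>K x\<bar> \<le> B" for x using g by (rule integral_pmf_abs_le)
  have DB: "\<bar>D t \<omega>\<bar> \<le> 2 * B" for t \<omega>
    using g[of "\<omega> (Suc t)"] Kg[of "\<omega> t"] by (simp add: D_def)
  have Dmeas: "D t \<in> borel_measurable (path_algebra J)" if "t \<in> J" "Suc t \<in> J" for t J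
    unfolding D_def using that
    by (intro borel_measurable_diff measurable_coordinate[where G=g]
        measurable_coordinate[where G="\<lambda>x. \<integral>y. g y \<partial>K x"])
  have "AE \<omega> in markov_law \<nu> K. (\<lambda>T. (\<Sum>t<T. D t \<omega>) / real T) \<longlonglongrightarrow> 0"
  proof (rule orthogonal_partial_sums_average[OF _ DB])
    show "D t \<in> borel_measurable (markov_law \<nu> K)" for t
      unfolding measurable_markov_law by (rule Dmeas) simp_all
    fix T
    define X where "X \<omega> = (\<Sum>t<T. D t \<omega>)" for \<omega>
    have X: "X \<in> borel_measurable (path_algebra {0..<Suc T})"
      unfolding X_def by (intro borel_measurable_sum Dmeas) auto
    have XB: "\<bar>X \<omega>\<bar> \<le> real T * (2 * B)" for \<omega>
    proof -
      have "\<bar>X \<omega>\<bar> \<le> (\<Sum>t<T. 2 * B)"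
        unfolding X_def by (rule order_trans[OF sum_abs]) (intro sum_mono DB)
      then show ?thesis by simp
    qed
    have past: "X (restrict \<omega> {0..<Suc T}) = X \<omega>" for \<omega>
      unfolding X_def D_def by (intro sum.cong refl) auto
    have Xm: "X \<in> borel_measurable (markov_law \<nu> K)"
      unfolding X_def measurable_markov_law by (intro borel_measurable_sum Dmeas) auto
    have int: "integrable (markov_law \<nu> K) (\<lambda>\<omega>. X \<omega> * G (\<omega> t))" if "\<And>x. \<bar>G x\<bar> \<le> B" for G t
    proof (rule integrable_const_bound)
      show "AE \<omega> in markov_law \<nu> K. norm (X \<omega> * G (\<omega> t)) \<le> real T * (2 * B) * B"
        using XB that \<open>0 \<le> B\<close> by (intro AE_I2) (auto simp: abs_mult intro!: mult_mono)
    qed (intro borel_measurable_times Xm measurable_markov_law_coordinate)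
    have "(\<integral>\<omega>. X \<omega> * D T \<omega> \<partial>markov_law \<nu> K) =
        (\<integral>\<omega>. X \<omega> * g (\<omega> (Suc T)) \<partial>markov_law \<nu> K) - (\<integral>\<omega>. X \<omega> * (\<integral>y. g y \<partial>K (\<omega> T)) \<partial>markov_law \<nu> K)"
      unfolding D_def right_diff_distrib using g Kg by (intro Bochner_Integration.integral_diff int)
    also have "\<dots> = 0"
      using markov_property[OF X XB past g, of \<nu> K] by simp
    finally show "(\<integral>\<omega>. (\<Sum>t<T. D t \<omega>) * D T \<omega> \<partial>markov_law \<nu> K) = 0"
      by (simp add: X_def)
  qed
  moreover have "AE \<omega> in markov_law \<nu> K. \<forall>t. \<omega> t \<in> Z"
    using \<nu> Z by (rule markov_law_AE_closed)
  ultimately show ?thesis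
  proof eventually_elim
    fix \<omega> :: "nat \<Rightarrow> 'x"
    assume D: "(\<lambda>T. (\<Sum>t<T. D t \<omega>) / real T) \<longlonglongrightarrow> 0" and \<omega>: "\<forall>t. \<omega> t \<in> Z"
    have "F (\<omega> t) - c = g (\<omega> t) - g (\<omega> (Suc t)) + D t \<omega>" for t
    proof -
      have "(\<integral>y. h y \<partial>K (\<omega> t)) = (\<integral>y. g y \<partial>K (\<omega> t))"
        using Z[of "\<omega> t"] \<omega> by (intro integral_pmf_cong) (auto simp: g_def)
      then show ?thesis using poisson[of "\<omega> t"] \<omega> by (simp add: D_def g_def)
    qed
    then have "(\<Sum>t<T. F (\<omega> t) - c) = g (\<omega> 0) - g (\<omega> T) + (\<Sum>t<T. D t \<omega>)" for T
      by (induction T) simp_all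
    then have eq: "(\<Sum>t<T. F (\<omega> t)) = real T * c + (g (\<omega> 0) - g (\<omega> T)) + (\<Sum>t<T. D t \<omega>)" for T
      by (simp add: sum_subtractf algebra_simps)
    have "(\<lambda>T. (g (\<omega> 0) - g (\<omega> T)) / real T) \<longlonglongrightarrow> 0"
    proof (rule Lim_null_comparison[OF _ lim_const_over_n])
      show "\<forall>\<^sub>F T in sequentially. norm ((g (\<omega> 0) - g (\<omega> T)) / real T) \<le> (2 * B) / real T"
      proof (intro always_eventually allI)
        fix T
        have "\<bar>g (\<omega> 0) - g (\<omega> T)\<bar> \<le> 2 * B" using g[of "\<omega> 0"] g[of "\<omega> T"] by linarith
        then show "norm ((g (\<omega> 0) - g (\<omega> T)) / real T) \<le> (2 * B) / real T"
          by (simp add: divide_right_mono)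
      qed
    qed
    then have lim: "(\<lambda>T. c + (g (\<omega> 0) - g (\<omega> T)) / real T + (\<Sum>t<T. D t \<omega>) / real T) \<longlonglongrightarrow> c + 0 + 0"
      using D by (intro tendsto_add tendsto_const)
    have "\<forall>\<^sub>F T in sequentially. 1 / real T * (\<Sum>t<T. F (\<omega> t)) =
        c + (g (\<omega> 0) - g (\<omega> T)) / real T + (\<Sum>t<T. D t \<omega>) / real T"
      using eventually_gt_at_top[of 0] by eventually_elim (simp add: eq field_simps)
    then show "(\<lambda>T. 1 / real T * (\<Sum>t<T. F (\<omega> t))) \<longlonglongrightarrow> c"
      using lim unfolding add_0_right by (rule tendsto_cong[THEN iffD2])
  qed
qed

section \<open>Expected time averages and the performance potential\<close>

text \<open>
  Time averages are defined by \<open>lim\<close>, which is arbitrary on trajectories without a limit; these form a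
  null set.
\<close>

lemma integral_time_average:
  fixes f :: "'i \<Rightarrow> nat \<Rightarrow> (nat \<Rightarrow> 'x) \<Rightarrow> real"
  assumes meas: "\<And>i t. i \<in> I \<Longrightarrow> f i t \<in> borel_measurable (markov_law \<nu> K)"
    and lim: "\<And>i. i \<in> I \<Longrightarrow> AE \<omega> in markov_law \<nu> K. (\<lambda>T. 1 / real T * (\<Sum>t<T. f i t \<omega>)) \<longlonglongrightarrow> c i"
    and fin: "finite I"
  shows "(\<integral>\<omega>. C * (\<Sum>i\<in>I. time_average (\<lambda>t. f i t \<omega>)) \<partial>markov_law \<nu> K) = C * (\<Sum>i\<in>I. c i)"
proof -
  interpret prob_space "markov_law \<nu> K" by (rule prob_space_markov_law)
  have "AE \<omega> in markov_law \<nu> K. \<forall>i\<in>I. (\<lambda>T. 1 / real T * (\<Sum>t<T. f i t \<omega>)) \<longlonglongrightarrow> c i"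
    using lim fin by (intro AE_finite_allI)
  then have ae: "AE \<omega> in markov_law \<nu> K. C * (\<Sum>i\<in>I. time_average (\<lambda>t. f i t \<omega>)) = C * (\<Sum>i\<in>I. c i)"
  proof eventually_elim
    fix \<omega> assume "\<forall>i\<in>I. (\<lambda>T. 1 / real T * (\<Sum>t<T. f i t \<omega>)) \<longlonglongrightarrow> c i"
    then have "(\<Sum>i\<in>I. time_average (\<lambda>t. f i t \<omega>)) = (\<Sum>i\<in>I. c i)"
      unfolding time_average_def by (intro sum.cong refl limI) blast
    then show "C * (\<Sum>i\<in>I. time_average (\<lambda>t. f i t \<omega>)) = C * (\<Sum>i\<in>I. c i)" by simp
  qed
  have "(\<integral>\<omega>. C * (\<Sum>i\<in>I. time_average (\<lambda>t. f i t \<omega>)) \<partial>markov_law \<nu> K) =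
      (\<integral>\<omega>. C * (\<Sum>i\<in>I. c i) \<partial>markov_law \<nu> K)"
  proof (rule integral_cong_AE[OF _ _ ae])
    show "(\<lambda>\<omega>. C * (\<Sum>i\<in>I. time_average (\<lambda>t. f i t \<omega>))) \<in> borel_measurable (markov_law \<nu> K)"
      unfolding time_average_def
      by (intro borel_measurable_times borel_measurable_sum borel_measurable_lim_metric
          borel_measurable_const meas)
  qed simp
  then show ?thesis using prob_space by simp
qed

lemma markov_law_marginal_closed:
  fixes f :: "'x \<Rightarrow> real"
  assumes \<nu>: "set_pmf \<nu> \<subseteq> Z" and Z: "\<And>x. x \<in> Z \<Longrightarrow> set_pmf (K x) \<subseteq> Z"
    and f: "\<And>x. x \<in> Z \<Longrightarrow> \<bar>f x\<bar> \<le> B"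
  shows "integrable (markov_law \<nu> K) (\<lambda>\<omega>. f (\<omega> t))"
    and "(\<integral>\<omega>. f (\<omega> t) \<partial>markov_law \<nu> K) = (\<integral>x. f x \<partial>bind_pmf \<nu> (n_step K t))"
proof -
  interpret prob_space "markov_law \<nu> K" by (rule prob_space_markov_law)
  define g where "g x = (if x \<in> Z then f x else 0)" for x
  have "0 \<le> B"
    using f set_pmf_not_empty[of \<nu>] \<nu> by (meson abs_ge_zero all_not_in_conv order_trans subsetD)
  then have g: "\<bar>g x\<bar> \<le> B" for x using f by (simp add: g_def)
  have ae: "AE \<omega> in markov_law \<nu> K. f (\<omega> t) = g (\<omega> t)"
  proof -
    have "AE \<omega> in markov_law \<nu> K. \<forall>t. \<omega> t \<in> Z"
      using \<nu> Z by (rule markov_law_AE_closed)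
    then show ?thesis by eventually_elim (simp add: g_def)
  qed
  have "integrable (markov_law \<nu> K) (\<lambda>\<omega>. g (\<omega> t))"
    using g by (intro integrable_const_bound[of _ B] AE_I2 measurable_markov_law_coordinate) simp
  then show "integrable (markov_law \<nu> K) (\<lambda>\<omega>. f (\<omega> t))"
    using integrable_cong_AE[OF measurable_markov_law_coordinate measurable_markov_law_coordinate ae]
    by blast
  have "(\<integral>\<omega>. f (\<omega> t) \<partial>markov_law \<nu> K) = (\<integral>\<omega>. g (\<omega> t) \<partial>markov_law \<nu> K)"
    by (rule integral_cong_AE[OF measurable_markov_law_coordinate measurable_markov_law_coordinate ae])
  also have "\<dots> = (\<integral>x. g x \<partial>bind_pmf \<nu> (n_step K t))"
    using g by (rule markov_law_marginal)
  also have "\<dots> = (\<integral>x. f x \<partial>bind_pmf \<nu> (n_step K t))"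
  proof (rule integral_pmf_cong)
    fix x assume "x \<in> set_pmf (bind_pmf \<nu> (n_step K t))"
    then have "x \<in> Z"
      using \<nu> set_n_step_closed[of Z K _ t, OF Z] unfolding set_bind_pmf by blast
    then show "g x = f x" by (simp add: g_def)
  qed
  finally show "(\<integral>\<omega>. f (\<omega> t) \<partial>markov_law \<nu> K) = (\<integral>x. f x \<partial>bind_pmf \<nu> (n_step K t))" .
qed

context primitive_chain
begin

lemma bounded_on_S:
  fixes f :: "'x \<Rightarrow> real"
  assumes "x \<in> S"
  shows "\<bar>f x\<bar> \<le> (\<Sum>y\<in>S. \<bar>f y\<bar>)"
  using member_le_sum[of x S "\<lambda>y. \<bar>f y\<bar>"] assms fin by simp

lemma AE_average_stationary:
  fixes f :: "'x \<Rightarrow> real"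
  assumes "s \<in> S"
  shows "AE \<omega> in markov_law (return_pmf s) K.
    (\<lambda>T. 1 / real T * (\<Sum>t<T. f (\<omega> t))) \<longlonglongrightarrow> (\<integral>x. f x \<partial>stat)"
proof -
  obtain h where "\<And>x. x \<in> S \<Longrightarrow> f x - (\<integral>y. f y \<partial>stat) = h x - (\<integral>y. h y \<partial>K x)"
    using poisson_equation[of f] by blast
  then show ?thesis
    using assms closed bounded_on_S[of _ h] by (intro markov_law_ergodic[where Z=S and h=h]) auto
qed

end

text \<open>
  On \<open>S\<close> the potential coincides with the solution constructed in \<open>poisson_equation\<close>: the long-run cost
  is the stationary mean by the ergodic theorem, and the expected partial sums are sums of iterates of
  the kernel.
\<close>

lemma potential_poisson:
  fixes \<rho> :: "'s \<Rightarrow> 'a \<Rightarrow> real" and y :: real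
  assumes "primitive_chain S (closed_loop q v)" and s: "s \<in> S"
  defines "cost \<equiv> \<lambda>x. (\<rho> x (v x) - y)\<^sup>2"
  shows "cost s - (\<integral>x. cost x \<partial>stationary_dist S (closed_loop q v)) =
    potential q \<rho> v y s - (\<integral>x. potential q \<rho> v y x \<partial>closed_loop q v s)"
proof -
  interpret primitive_chain S "closed_loop q v" by fact
  obtain h where h: "\<And>x. x \<in> S \<Longrightarrow> (\<lambda>T. \<Sum>t<T. P t cost x - (\<integral>y. cost y \<partial>stat)) \<longlonglongrightarrow> h x"
    "\<And>x. x \<in> S \<Longrightarrow> cost x - (\<integral>y. cost y \<partial>stat) = h x - (\<integral>y. h y \<partial>closed_loop q v x)"
    using poisson_equation[of cost] by blast
  have cost: "player_cost q \<rho> v y x = (\<integral>y. cost y \<partial>stat)" if "x \<in> S" for x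
  proof -
    have "(\<integral>\<omega>. 1 * (\<Sum>i\<in>{()}. time_average (\<lambda>t. cost (\<omega> t))) \<partial>markov_law (return_pmf x) (closed_loop q v)) =
        1 * (\<Sum>i\<in>{()}. (\<integral>y. cost y \<partial>stat))"
      using AE_average_stationary[OF that, of cost]
      by (intro integral_time_average) (auto intro: measurable_markov_law_coordinate)
    then show ?thesis by (simp add: player_cost_def cost_def)
  qed
  have "potential q \<rho> v y x = h x" if x: "x \<in> S" for x
  proof -
    interpret M: prob_space "markov_law (return_pmf x) (closed_loop q v)" by (rule prob_space_markov_law)
    have closed': "set_pmf (return_pmf x) \<subseteq> S" using x by simp
    have E: "integrable (markov_law (return_pmf x) (closed_loop q v)) (\<lambda>\<omega>. cost (\<omega> t))"
        "(\<integral>\<omega>. cost (\<omega> t) \<partial>markov_law (return_pmf x) (closed_loop q v)) = P t cost x" for t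
      using markov_law_marginal_closed[of "return_pmf x" S "closed_loop q v" cost, OF closed' closed bounded_on_S]
      by (simp_all add: bind_return_pmf)
    have "(\<integral>\<omega>. (\<Sum>t<T. cost (\<omega> t) - (\<integral>y. cost y \<partial>stat)) \<partial>markov_law (return_pmf x) (closed_loop q v)) =
        (\<Sum>t<T. P t cost x - (\<integral>y. cost y \<partial>stat))" for T
      by (subst Bochner_Integration.integral_sum) (auto simp: E M.prob_space[simplified])
    then have "potential q \<rho> v y x = lim (\<lambda>T. \<Sum>t<T. P t cost x - (\<integral>y. cost y \<partial>stat))"
      by (simp add: potential_def cost[OF x]) (simp add: cost_def)
    also have "\<dots> = h x" using h(1)[OF x] by (rule limI)
    finally show ?thesis .
  qed
  moreover from this have "(\<integral>x. potential q \<rho> v y x \<partial>closed_loop q v s) = (\<integral>x. h x \<partial>closed_loop q v s)"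
    using closed[OF s] by (intro integral_pmf_cong) auto
  ultimately show ?thesis using h(2)[OF s] s by simp
qed


section \<open>Long-run averages of the team\<close>

definition induced_chain :: "('s \<Rightarrow> 'a \<Rightarrow> 's pmf) \<Rightarrow> ('s \<Rightarrow> 'a pmf) \<Rightarrow> 's \<Rightarrow> 's pmf" where
  "induced_chain q w s = bind_pmf (w s) (q s)"

definition long_run_average ::
  "'s set \<Rightarrow> ('s \<Rightarrow> 'a \<Rightarrow> 's pmf) \<Rightarrow> ('s \<Rightarrow> 'a pmf) \<Rightarrow> ('s \<Rightarrow> 'a \<Rightarrow> real) \<Rightarrow> real" where
  "long_run_average S q w f =
     (\<integral>s. (\<integral>a. f s a \<partial>w s) \<partial>stationary_dist S (induced_chain q w))"

text \<open>
  What player \<open>i\<close> sees of one joint step: the other players' coordinates integrate out, since players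
  act and move independently.
\<close>

lemma map_joint_step:
  assumes i: "i \<in> {1..n}"
  shows "map_pmf (\<lambda>x. (fst x i, snd x i)) (bind_pmf (joint_transition n p s a) (attach_action n w)) =
    bind_pmf (p i (s i) (a i)) (\<lambda>s'. map_pmf (Pair s') (w i s'))"
proof -
  have "map_pmf (\<lambda>x. (fst x i, snd x i)) (attach_action n w s') = map_pmf (Pair (s' i)) (w i (s' i))" for s'
  proof -
    have "map_pmf (\<lambda>x. (fst x i, snd x i)) (attach_action n w s') =
        map_pmf (Pair (s' i)) (map_pmf (\<lambda>a. a i) (joint_action n w s'))"
      unfolding attach_action_def map_pmf_comp by simp
    then show ?thesis using i by (simp add: joint_action_def Pi_pmf_component)
  qed
  then have "map_pmf (\<lambda>x. (fst x i, snd x i)) (bind_pmf (joint_transition n p s a) (attach_action n w)) =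
      bind_pmf (joint_transition n p s a) (\<lambda>s'. map_pmf (Pair (s' i)) (w i (s' i)))"
    unfolding map_bind_pmf by simp
  also have "\<dots> = bind_pmf (map_pmf (\<lambda>s'. s' i) (joint_transition n p s a)) (\<lambda>s'. map_pmf (Pair s') (w i s'))"
    unfolding bind_map_pmf ..
  also have "map_pmf (\<lambda>s'. s' i) (joint_transition n p s a) = p i (s i) (a i)"
    using i by (simp add: joint_transition_def Pi_pmf_component)
  finally show ?thesis .
qed

locale team =
  fixes n :: nat and S :: "nat \<Rightarrow> 's set" and A :: "nat \<Rightarrow> 'a set"
    and p :: "nat \<Rightarrow> 's \<Rightarrow> 'a \<Rightarrow> 's pmf" and \<nu> :: "(nat \<Rightarrow> 's) pmf" and w :: "nat \<Rightarrow> 's \<Rightarrow> 'a pmf"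
  assumes finA: "\<And>i. i \<in> {1..n} \<Longrightarrow> finite (A i)"
    and policy: "\<And>i s. i \<in> {1..n} \<Longrightarrow> s \<in> S i \<Longrightarrow> set_pmf (w i s) \<subseteq> A i"
    and trans: "\<And>i s a. i \<in> {1..n} \<Longrightarrow> s \<in> S i \<Longrightarrow> a \<in> A i \<Longrightarrow> set_pmf (p i s a) \<subseteq> S i"
    and init: "\<And>s. s \<in> set_pmf \<nu> \<Longrightarrow> \<forall>i\<in>{1..n}. s i \<in> S i"
    and chain: "\<And>i. i \<in> {1..n} \<Longrightarrow> primitive_chain (S i) (induced_chain (p i) (w i))"
begin

text \<open>
  If \<open>h\<close> solves the Poisson equation of the state chain of player \<open>i\<close> for the mean reward per state,
  then \<open>H s a = f s a - c + (\<integral>s'. h s' \<partial>p i s a)\<close> solves it on the joint chain for the reward itself: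
  averaging \<open>H\<close> over the action in state \<open>s\<close> gives back \<open>h s\<close>, so one joint step maps \<open>H\<close> to the
  integral of \<open>h\<close>.
\<close>

lemma AE_player_average:
  assumes i: "i \<in> {1..n}"
  shows "AE \<omega> in team_law n p \<nu> w.
    (\<lambda>T. 1 / real T * (\<Sum>t<T. f (fst (\<omega> t) i) (snd (\<omega> t) i)))
      \<longlonglongrightarrow> long_run_average (S i) (p i) (w i) f"
proof -
  interpret primitive_chain "S i" "induced_chain (p i) (w i)" by (rule chain[OF i])
  define c where "c = long_run_average (S i) (p i) (w i) f"
  obtain h where h: "\<And>s. s \<in> S i \<Longrightarrow>
      (\<integral>a. f s a \<partial>w i s) - c = h s - (\<integral>s'. h s' \<partial>induced_chain (p i) (w i) s)"
    using poisson_equation[of "\<lambda>s. \<integral>a. f s a \<partial>w i s"]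
    unfolding c_def long_run_average_def by blast
  define H where "H s a = f s a - c + (\<integral>s'. h s' \<partial>p i s a)" for s a
  define Z where "Z = {(s :: nat \<Rightarrow> 's, a :: nat \<Rightarrow> 'a). \<forall>j\<in>{1..n}. s j \<in> S j \<and> a j \<in> A j}"
  let ?L = "\<lambda>(s, a). bind_pmf (joint_transition n p s a) (attach_action n w)"
  have attach: "set_pmf (attach_action n w s) \<subseteq> Z" if "\<forall>j\<in>{1..n}. s j \<in> S j" for s
  proof
    fix x assume "x \<in> set_pmf (attach_action n w s)"
    then obtain a where x: "x = (s, a)" and "a \<in> set_pmf (joint_action n w s)"
      by (auto simp: attach_action_def)
    then have "a j \<in> A j" if "j \<in> {1..n}" for j
      using policy[OF that, of "s j"] that \<open>\<forall>j\<in>{1..n}. s j \<in> S j\<close>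
      unfolding joint_action_def by (auto simp: set_Pi_pmf PiE_dflt_def)
    then show "x \<in> Z" using that by (simp add: x Z_def)
  qed
  have closedZ: "set_pmf (?L x) \<subseteq> Z" if "x \<in> Z" for x
  proof -
    obtain s a where x: "x = (s, a)" by (cases x)
    have sa: "s j \<in> S j" "a j \<in> A j" if "j \<in> {1..n}" for j
      using \<open>x \<in> Z\<close> that by (auto simp: x Z_def)
    have "s' j \<in> S j" if "s' \<in> set_pmf (joint_transition n p s a)" "j \<in> {1..n}" for s' j
      using that trans[OF that(2) sa[OF that(2)]]
      unfolding joint_transition_def by (auto simp: set_Pi_pmf PiE_dflt_def)
    then have "set_pmf (attach_action n w s') \<subseteq> Z" if "s' \<in> set_pmf (joint_transition n p s a)" for s'
      using that by (intro attach) blast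
    then show ?thesis by (simp add: x set_bind_pmf UN_least)
  qed
  have averaged: "(\<integral>a. H s a \<partial>w i s) = h s" if s: "s \<in> S i" for s
  proof -
    have fw: "finite (set_pmf (w i s))"
      using policy[OF i s] finA[OF i] by (rule finite_subset)
    have "(\<integral>a. H s a \<partial>w i s) = (\<integral>a. f s a \<partial>w i s) - c + (\<integral>a. (\<integral>s'. h s' \<partial>p i s a) \<partial>w i s)"
      unfolding H_def by (simp add: integrable_measure_pmf_finite[OF fw])
    also have "(\<integral>a. (\<integral>s'. h s' \<partial>p i s a) \<partial>w i s) = (\<integral>s'. h s' \<partial>induced_chain (p i) (w i) s)"
      unfolding induced_chain_def
      using fw policy[OF i s] trans[OF i s]
      by (intro integral_bind_pmf_finite[symmetric]) (auto intro!: finite_support)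
    finally show ?thesis using h[OF s] by simp
  qed
  have "AE \<omega> in team_law n p \<nu> w.
    (\<lambda>T. 1 / real T * (\<Sum>t<T. (\<lambda>x. f (fst x i) (snd x i)) (\<omega> t))) \<longlonglongrightarrow> c"
    unfolding team_law_def
  proof (rule markov_law_ergodic[where Z=Z and h="\<lambda>x. H (fst x i) (snd x i)" and B="\<Sum>s\<in>S i. \<Sum>a\<in>A i. \<bar>H s a\<bar>"])
    show "set_pmf (bind_pmf \<nu> (attach_action n w)) \<subseteq> Z"
      using attach init by (simp add: set_bind_pmf) blast
    show "set_pmf (?L x) \<subseteq> Z" if "x \<in> Z" for x using that by (rule closedZ)
    fix x assume "x \<in> Z"
    then have x: "fst x i \<in> S i" "snd x i \<in> A i" using i by (auto simp: Z_def)
    have "\<bar>H (fst x i) (snd x i)\<bar> \<le> (\<Sum>a\<in>A i. \<bar>H (fst x i) a\<bar>)"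
      using member_le_sum[of "snd x i" "A i" "\<lambda>a. \<bar>H (fst x i) a\<bar>"] x finA[OF i] by simp
    also have "\<dots> \<le> (\<Sum>s\<in>S i. \<Sum>a\<in>A i. \<bar>H s a\<bar>)"
      using member_le_sum[of "fst x i" "S i" "\<lambda>s. \<Sum>a\<in>A i. \<bar>H s a\<bar>"] x fin
      by (simp add: sum_nonneg)
    finally show "\<bar>H (fst x i) (snd x i)\<bar> \<le> (\<Sum>s\<in>S i. \<Sum>a\<in>A i. \<bar>H s a\<bar>)" .
    have "(\<integral>y. H (fst y i) (snd y i) \<partial>?L x) =
        (\<integral>y. H (fst y) (snd y) \<partial>map_pmf (\<lambda>x. (fst x i, snd x i)) (?L x))"
      by simp
    also have "map_pmf (\<lambda>x. (fst x i, snd x i)) (?L x) =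
        bind_pmf (p i (fst x i) (snd x i)) (\<lambda>s'. map_pmf (Pair s') (w i s'))"
      unfolding case_prod_beta by (rule map_joint_step[OF i])
    also have "(\<integral>y. H (fst y) (snd y) \<partial>\<dots>) = (\<integral>s'. (\<integral>a. H s' a \<partial>w i s') \<partial>p i (fst x i) (snd x i))"
    proof (subst integral_bind_pmf_finite)
      show "finite (set_pmf (p i (fst x i) (snd x i)))"
        using trans[OF i x] by (rule finite_support)
      fix s' assume "s' \<in> set_pmf (p i (fst x i) (snd x i))"
      then have "s' \<in> S i" using trans[OF i x] by blast
      then show "finite (set_pmf (map_pmf (Pair s') (w i s')))"
        using finite_subset[OF policy[OF i] finA[OF i]] by simp
    qed simp
    also have "\<dots> = (\<integral>s'. h s' \<partial>p i (fst x i) (snd x i))"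
      using trans[OF i x] averaged by (intro integral_pmf_cong) blast
    finally show "f (fst x i) (snd x i) - c = H (fst x i) (snd x i) - (\<integral>y. H (fst y i) (snd y i) \<partial>?L x)"
      by (simp add: H_def)
  qed
  then show ?thesis by (simp add: c_def)
qed

lemma integral_team_average:
  "(\<integral>\<omega>. C * (\<Sum>i=1..n. time_average (\<lambda>t. f i (fst (\<omega> t) i) (snd (\<omega> t) i))) \<partial>team_law n p \<nu> w) =
    C * (\<Sum>i=1..n. long_run_average (S i) (p i) (w i) (f i))"
  using AE_player_average unfolding team_law_def
  by (intro integral_time_average) (auto intro: measurable_markov_law_coordinate)

lemma team_mean_eq:
  "team_mean n p r \<nu> w = 1 / real n * (\<Sum>i=1..n. long_run_average (S i) (p i) (w i) (r i))"
  unfolding team_mean_def by (rule integral_team_average)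

lemma team_variance_eq:
  "team_variance n p r \<nu> w =
    (\<Sum>i=1..n. long_run_average (S i) (p i) (w i) (\<lambda>s a. (r i s a - team_mean n p r \<nu> w)\<^sup>2))"
  unfolding team_variance_def
  using integral_team_average[of 1 "\<lambda>i s a. (r i s a - team_mean n p r \<nu> w)\<^sup>2"] by simp

end

section \<open>Dependence of a player's long-run average on the mixing parameter\<close>

definition randomize :: "('s \<Rightarrow> 'a) \<Rightarrow> ('s \<Rightarrow> 'a) \<Rightarrow> real \<Rightarrow> 's \<Rightarrow> 'a pmf" where
  "randomize v v' \<delta> s = map_pmf (\<lambda>b. if b then v' s else v s) (bernoulli_pmf \<delta>)"

lemma mixed_policy_eq: "mixed_policy u u' \<delta> i = randomize (u i) (u' i) \<delta>"
  by (simp add: fun_eq_iff mixed_policy_def randomize_def)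

lemma set_randomize: "set_pmf (randomize v v' \<delta> s) \<subseteq> {v s, v' s}"
  by (auto simp: randomize_def)

lemma finite_set_randomize: "finite (set_pmf (randomize v v' \<delta> s))"
  using set_randomize by (rule finite_subset) simp

lemma integral_randomize:
  assumes "0 \<le> \<delta>" "\<delta> \<le> 1"
  shows "(\<integral>a. f a \<partial>randomize v v' \<delta> s) = (1 - \<delta>) * f (v s) + \<delta> * (f (v' s) :: real)"
  using assms by (simp add: randomize_def)


lemma randomize_0: "randomize v v' 0 s = return_pmf (v s)"
proof -
  have "bernoulli_pmf 0 = return_pmf False"
  proof (rule pmf_eqI)
    fix b show "pmf (bernoulli_pmf 0) b = pmf (return_pmf False) b"
      by (cases b) simp_all
  qed
  then show ?thesis by (simp add: randomize_def)
qed

lemma induced_chain_randomize_0: "induced_chain q (randomize v v' 0) = closed_loop q v"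
  by (simp add: fun_eq_iff induced_chain_def closed_loop_def randomize_0 bind_return_pmf)

lemma set_randomize_less_1:
  assumes "0 \<le> \<delta>" "\<delta> < 1"
  shows "v s \<in> set_pmf (randomize v v' \<delta> s)"
proof -
  have "False \<in> set_pmf (bernoulli_pmf \<delta>)" using assms by (simp add: set_pmf_iff)
  then show ?thesis by (force simp: randomize_def)
qed

locale two_policies =
  fixes S :: "'s set" and q :: "'s \<Rightarrow> 'a \<Rightarrow> 's pmf" and v v' :: "'s \<Rightarrow> 'a"
  assumes base: "primitive_chain S (closed_loop q v)"
    and closed': "\<And>s. s \<in> S \<Longrightarrow> set_pmf (q s (v' s)) \<subseteq> S"
begin

abbreviation chain :: "real \<Rightarrow> 's \<Rightarrow> 's pmf" where
  "chain \<delta> \<equiv> induced_chain q (randomize v v' \<delta>)"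

abbreviation inv_dist :: "real \<Rightarrow> 's pmf" where
  "inv_dist \<delta> \<equiv> stationary_dist S (chain \<delta>)"

text \<open>
  For \<open>\<delta> < 1\<close> every transition possible under \<open>v\<close> remains possible, hence so does every \<open>m\<close>-step
  transition.
\<close>

lemma primitive_chain_randomize:
  assumes \<delta>: "0 \<le> \<delta>" "\<delta> < 1"
  shows "primitive_chain S (chain \<delta>)"
proof -
  interpret base: primitive_chain S "closed_loop q v" by (rule base)
  show ?thesis
  proof
    show "finite S" "S \<noteq> {}" by (rule base.fin base.nonempty)+
    show "set_pmf (chain \<delta> s) \<subseteq> S" if "s \<in> S" for s
    proof -
      have "set_pmf (q s a) \<subseteq> S" if "a \<in> {v s, v' s}" for a
        using that base.closed[OF \<open>s \<in> S\<close>] closed'[OF \<open>s \<in> S\<close>] by (auto simp: closed_loop_def)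
      then show ?thesis
        using set_randomize[of v v' \<delta> s] unfolding induced_chain_def set_bind_pmf by blast
    qed
    have one: "set_pmf (closed_loop q v s) \<subseteq> set_pmf (chain \<delta> s)" for s
      using set_randomize_less_1[OF \<delta>, of v s v'] unfolding induced_chain_def closed_loop_def set_bind_pmf
      by blast
    have "set_pmf (n_step (closed_loop q v) m s) \<subseteq> set_pmf (n_step (chain \<delta>) m s)" for m s
    proof (induction m arbitrary: s)
      case (Suc m)
      show ?case unfolding n_step.simps set_bind_pmf using one Suc by (rule UN_mono)
    qed simp
    then show "\<exists>m. \<forall>x\<in>S. \<forall>y\<in>S. y \<in> set_pmf (n_step (chain \<delta>) m x)"
      using base.primitive by blast
  qed
qed

lemma integral_chain:
  fixes g :: "'s \<Rightarrow> real"
  assumes \<delta>: "0 \<le> \<delta>" "\<delta> \<le> 1" and s: "s \<in> S"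
  shows "(\<integral>x. g x \<partial>chain \<delta> s) = (1 - \<delta>) * (\<integral>x. g x \<partial>q s (v s)) + \<delta> * (\<integral>x. g x \<partial>q s (v' s))"
proof -
  interpret base: primitive_chain S "closed_loop q v" by (rule base)
  have "finite (set_pmf (q s a))" if "a \<in> set_pmf (randomize v v' \<delta> s)" for a
    using that set_randomize[of v v' \<delta> s] base.closed[OF s] closed'[OF s]
    by (auto simp: closed_loop_def intro: base.finite_support)
  then have "(\<integral>x. g x \<partial>chain \<delta> s) = (\<integral>a. (\<integral>x. g x \<partial>q s a) \<partial>randomize v v' \<delta> s)"
    unfolding induced_chain_def by (rule integral_bind_pmf_finite[OF finite_set_randomize])
  then show ?thesis using integral_randomize[OF \<delta>] by simp
qed

text \<open>
  The integrand \<open>(P' - P) g + f' - f\<close> of the derivative formula: the gain in state \<open>s\<close> from using the action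
  of \<open>v'\<close> once in place of that of \<open>v\<close>, when \<open>g\<close> values the next state.
\<close>

definition advantage :: "('s \<Rightarrow> 'a \<Rightarrow> real) \<Rightarrow> ('s \<Rightarrow> real) \<Rightarrow> 's \<Rightarrow> real" where
  "advantage f g s = (\<integral>x. g x \<partial>q s (v' s)) - (\<integral>x. g x \<partial>q s (v s)) + f s (v' s) - f s (v s)"

text \<open>
  The identity is exact, with the stationary distribution of the mixed chain but the Poisson solution
  \<open>g\<close> of the unmixed one. It follows by integrating the Poisson equation against the former,
  under which \<open>g\<close> and its image under the mixed chain have the same mean.
\<close>

lemma long_run_average_difference:
  assumes \<delta>: "0 \<le> \<delta>" "\<delta> < 1"
    and g: "\<And>s. s \<in> S \<Longrightarrow> f s (v s) - \<eta> = g s - (\<integral>x. g x \<partial>closed_loop q v s)"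
  shows "long_run_average S q (randomize v v' \<delta>) f - \<eta> = \<delta> * (\<integral>s. advantage f g s \<partial>inv_dist \<delta>)"
proof -
  interpret primitive_chain S "chain \<delta>" by (rule primitive_chain_randomize[OF \<delta>])
  have int: "integrable (inv_dist \<delta>) w" for w :: "'s \<Rightarrow> real"
    by (rule integrable_measure_pmf_finite[OF finite_support[OF stationary(1)]])
  have inv: "(\<integral>s. (\<integral>x. g x \<partial>chain \<delta> s) \<partial>inv_dist \<delta>) = (\<integral>s. g s \<partial>inv_dist \<delta>)"
    using integral_bind_S[OF stationary(1), where f=g and k="chain \<delta>"] closed
    unfolding stationary(2) by simp
  have "(\<integral>s. (\<integral>a. f s a \<partial>randomize v v' \<delta> s) - \<eta> \<partial>inv_dist \<delta>) =
      (\<integral>s. g s - (\<integral>x. g x \<partial>chain \<delta> s) + \<delta> * advantage f g s \<partial>inv_dist \<delta>)"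
  proof (rule integral_pmf_cong)
    fix s assume "s \<in> set_pmf (inv_dist \<delta>)"
    then have s: "s \<in> S" using stationary(1) by blast
    have base: "(\<integral>x. g x \<partial>q s (v s)) = \<eta> + g s - f s (v s)"
      using g[OF s] by (simp add: closed_loop_def)
    have \<delta>': "\<delta> \<le> 1" using \<delta> by simp
    show "(\<integral>a. f s a \<partial>randomize v v' \<delta> s) - \<eta> = g s - (\<integral>x. g x \<partial>chain \<delta> s) + \<delta> * advantage f g s"
      unfolding integral_chain[OF \<delta>(1) \<delta>' s] integral_randomize[OF \<delta>(1) \<delta>'] advantage_def base
      by (simp add: algebra_simps)
  qed
  also have "\<dots> = \<delta> * (\<integral>s. advantage f g s \<partial>inv_dist \<delta>)"
    by (simp add: int inv)
  finally show ?thesis by (simp add: long_run_average_def int)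
qed

lemma eventually_mixing: "\<forall>\<^sub>F \<delta> in at 0 within {0..1}. 0 < \<delta> \<and> \<delta> < (1::real)"
  unfolding eventually_at by (rule exI[of _ 1]) (auto simp: dist_real_def)

text \<open>
  Applied to a cost \<open>\<phi>\<close> that ignores the action, the difference formula bounds the change of the
  stationary mean of \<open>\<phi>\<close> by \<open>\<delta>\<close> times a constant.
\<close>

lemma inv_dist_continuous:
  fixes \<phi> :: "'s \<Rightarrow> real"
  shows "((\<lambda>\<delta>. \<integral>s. \<phi> s \<partial>inv_dist \<delta>) \<longlongrightarrow> (\<integral>s. \<phi> s \<partial>inv_dist 0)) (at 0 within {0..1})"
proof -
  interpret base: primitive_chain S "closed_loop q v" by (rule base)
  define \<eta> where "\<eta> = (\<integral>s. \<phi> s \<partial>inv_dist 0)"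
  obtain g where g: "\<And>s. s \<in> S \<Longrightarrow> \<phi> s - \<eta> = g s - (\<integral>x. g x \<partial>closed_loop q v s)"
    using base.poisson_equation[of \<phi>] unfolding \<eta>_def induced_chain_randomize_0 by blast
  define B where "B = (\<Sum>s\<in>S. \<bar>advantage (\<lambda>s _. \<phi> s) g s\<bar>)"
  have B: "\<bar>(\<integral>s. \<phi> s \<partial>inv_dist \<delta>) - \<eta>\<bar> \<le> \<delta> * B" if \<delta>: "0 < \<delta>" "\<delta> < 1" for \<delta>
  proof -
    interpret primitive_chain S "chain \<delta>" using \<delta> by (intro primitive_chain_randomize) auto
    have "- B \<le> advantage (\<lambda>s _. \<phi> s) g s \<and> advantage (\<lambda>s _. \<phi> s) g s \<le> B" if "s \<in> S" for s
      using bounded_on_S[OF that, of "advantage (\<lambda>s _. \<phi> s) g"] unfolding B_def by linarith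
    then have "- B \<le> (\<integral>s. advantage (\<lambda>s _. \<phi> s) g s \<partial>inv_dist \<delta>) \<and> (\<integral>s. advantage (\<lambda>s _. \<phi> s) g s \<partial>inv_dist \<delta>) \<le> B"
      by (rule integral_S_between[OF stationary(1)])
    then have "\<bar>\<delta> * (\<integral>s. advantage (\<lambda>s _. \<phi> s) g s \<partial>inv_dist \<delta>)\<bar> \<le> \<delta> * B"
      using \<delta> by (simp add: abs_mult mult_left_mono abs_le_iff)
    then show ?thesis
      using long_run_average_difference[of \<delta> "\<lambda>s _. \<phi> s" \<eta> g] g \<delta>
      by (simp add: long_run_average_def)
  qed
  have "((\<lambda>\<delta>. (\<integral>s. \<phi> s \<partial>inv_dist \<delta>) - \<eta>) \<longlongrightarrow> 0) (at 0 within {0..1})"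
  proof (rule Lim_null_comparison)
    show "\<forall>\<^sub>F \<delta> in at 0 within {0..1}. norm ((\<integral>s. \<phi> s \<partial>inv_dist \<delta>) - \<eta>) \<le> \<delta> * B"
      using eventually_mixing by eventually_elim (simp add: B)
    have "((\<lambda>\<delta>. \<delta> * B) \<longlongrightarrow> 0 * B) (at 0 within {0..1})"
      by (intro tendsto_mult tendsto_const tendsto_ident_at)
    then show "((\<lambda>\<delta>. \<delta> * B) \<longlongrightarrow> 0) (at 0 within {0..1})" by simp
  qed
  then show ?thesis unfolding \<eta>_def by (simp add: LIM_zero_iff)
qed

text \<open>
  The difference quotient is the \<open>inv_dist \<delta>\<close>-mean of a function that does not depend on \<open>\<delta>\<close>.
\<close>

theorem long_run_average_derivative:
  assumes g: "\<And>s. s \<in> S \<Longrightarrow> f s (v s) - \<eta> = g s - (\<integral>x. g x \<partial>closed_loop q v s)"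
  shows "((\<lambda>\<delta>. long_run_average S q (randomize v v' \<delta>) f) has_real_derivative
    (\<integral>s. advantage f g s \<partial>inv_dist 0)) (at 0 within {0..1})"
  unfolding has_field_derivative_iff
proof (rule Lim_transform_eventually[OF inv_dist_continuous])
  have 0: "long_run_average S q (randomize v v' 0) f = \<eta>"
    using long_run_average_difference[of 0 f \<eta> g] g by simp
  show "\<forall>\<^sub>F \<delta> in at 0 within {0..1}. (\<integral>s. advantage f g s \<partial>inv_dist \<delta>) =
      (long_run_average S q (randomize v v' \<delta>) f - long_run_average S q (randomize v v' 0) f) / (\<delta> - 0)"
    using eventually_mixing
  proof eventually_elim
    fix \<delta> :: real assume "0 < \<delta> \<and> \<delta> < 1"
    then show "(\<integral>s. advantage f g s \<partial>inv_dist \<delta>) =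
      (long_run_average S q (randomize v v' \<delta>) f - long_run_average S q (randomize v v' 0) f) / (\<delta> - 0)"
      using long_run_average_difference[of \<delta> f \<eta> g] g by (simp add: 0)
  qed
qed

lemma long_run_average_differentiable:
  "\<exists>D. ((\<lambda>\<delta>. long_run_average S q (randomize v v' \<delta>) f) has_real_derivative D) (at 0 within {0..1})"
proof -
  interpret base: primitive_chain S "closed_loop q v" by (rule base)
  show ?thesis
    using base.poisson_equation[of "\<lambda>s. f s (v s)"] long_run_average_derivative by blast
qed

lemma long_run_average_square:
  assumes \<delta>: "0 \<le> \<delta>" "\<delta> < 1"
  shows "long_run_average S q (randomize v v' \<delta>) (\<lambda>s a. (\<rho> s a - y)\<^sup>2) =
    long_run_average S q (randomize v v' \<delta>) (\<lambda>s a. (\<rho> s a - x)\<^sup>2)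
     - 2 * (y - x) * (long_run_average S q (randomize v v' \<delta>) \<rho> - x) + (y - x)\<^sup>2"
proof -
  interpret primitive_chain S "chain \<delta>" by (rule primitive_chain_randomize[OF \<delta>])
  have int: "integrable (inv_dist \<delta>) w" for w :: "'s \<Rightarrow> real"
    by (rule integrable_measure_pmf_finite[OF finite_support[OF stationary(1)]])
  note int' = integrable_measure_pmf_finite[OF finite_set_randomize]
  have "(\<rho> s a - y)\<^sup>2 = (\<rho> s a - x)\<^sup>2 - 2 * (y - x) * (\<rho> s a - x) + (y - x)\<^sup>2" for s a
    by (simp add: power2_eq_square algebra_simps)
  then show ?thesis
    unfolding long_run_average_def by (simp add: int int')
qed

lemma integral_advantage:
  "(\<integral>s. advantage f g s \<partial>inv_dist 0) =
    (\<Sum>s\<in>S. pmf (stationary_dist S (closed_loop q v)) s *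
      ((\<Sum>s'\<in>S. (pmf (closed_loop q v' s) s' - pmf (closed_loop q v s) s') * g s')
        + f s (v' s) - f s (v s)))"
proof -
  interpret base: primitive_chain S "closed_loop q v" by (rule base)
  have "advantage f g s = (\<Sum>s'\<in>S. (pmf (closed_loop q v' s) s' - pmf (closed_loop q v s) s') * g s')
        + f s (v' s) - f s (v s)" if s: "s \<in> S" for s
  proof -
    have "(\<integral>x. g x \<partial>q s (v s)) = (\<Sum>x\<in>S. pmf (q s (v s)) x * g x)"
      using base.closed[OF s] base.fin by (subst integral_measure_pmf[of S]) (auto simp: closed_loop_def)
    moreover have "(\<integral>x. g x \<partial>q s (v' s)) = (\<Sum>x\<in>S. pmf (q s (v' s)) x * g x)"
      using closed'[OF s] base.fin by (subst integral_measure_pmf[of S]) auto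
    ultimately show ?thesis
      by (simp add: advantage_def closed_loop_def left_diff_distrib sum_subtractf)
  qed
  moreover have "(\<integral>s. advantage f g s \<partial>base.stat) = (\<Sum>s\<in>S. pmf base.stat s * advantage f g s)"
    using base.stationary(1) base.fin by (subst integral_measure_pmf[of S]) auto
  ultimately show ?thesis unfolding induced_chain_randomize_0 by simp
qed

end

section \<open>The derivative of the team variance\<close>

theorem mainTheorem4:
  fixes n :: nat
    and S :: "nat \<Rightarrow> 's set"
    and A :: "nat \<Rightarrow> 'a set"
    and p :: "nat \<Rightarrow> 's \<Rightarrow> 'a \<Rightarrow> 's pmf"
    and r :: "nat \<Rightarrow> 's \<Rightarrow> 'a \<Rightarrow> real"
    and \<nu> :: "(nat \<Rightarrow> 's) pmf"
    and u u' :: "nat \<Rightarrow> 's \<Rightarrow> 'a"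
    and \<mu> :: real
  assumes "1 \<le> n"
    and "\<And>i. i \<in> {1..n} \<Longrightarrow> finite (S i) \<and> S i \<noteq> {}"
    and "\<And>i. i \<in> {1..n} \<Longrightarrow> finite (A i) \<and> A i \<noteq> {}"
    and "\<And>i s a. \<lbrakk>i \<in> {1..n}; s \<in> S i; a \<in> A i\<rbrakk> \<Longrightarrow> set_pmf (p i s a) \<subseteq> S i"
    and "\<And>i v. \<lbrakk>i \<in> {1..n}; v \<in> S i \<rightarrow> A i\<rbrakk> \<Longrightarrow> ergodic_chain (S i) (closed_loop (p i) v)"
    and "\<And>s. s \<in> set_pmf \<nu> \<Longrightarrow> \<forall>i\<in>{1..n}. s i \<in> S i"
    and "\<forall>i\<in>{1..n}. u i \<in> S i \<rightarrow> A i"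
    and "\<forall>i\<in>{1..n}. u' i \<in> S i \<rightarrow> A i"
    and "\<mu> = team_mean n p r \<nu> (deterministic_policy u)"
  shows "((\<lambda>\<delta>. team_variance n p r \<nu> (mixed_policy u u' \<delta>)) has_real_derivative
      (\<Sum>i=1..n. \<Sum>s\<in>S i. pmf (stationary_dist (S i) (closed_loop (p i) (u i))) s *
         ((\<Sum>s'\<in>S i. (pmf (closed_loop (p i) (u' i) s) s' - pmf (closed_loop (p i) (u i) s) s')
              * potential (p i) (r i) (u i) \<mu> s')
          + (r i s (u' i s) - \<mu>)\<^sup>2 - (r i s (u i s) - \<mu>)\<^sup>2)))
    (at 0 within {0..1})"
proof -
  have act: "u i s \<in> A i" "u' i s \<in> A i" if "i \<in> {1..n}" "s \<in> S i" for i s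
    using that assms(7,8) by (auto simp: Pi_iff)
  have closed: "set_pmf (p i s (u i s)) \<subseteq> S i" "set_pmf (p i s (u' i s)) \<subseteq> S i"
    if "i \<in> {1..n}" "s \<in> S i" for i s
    using assms(4)[OF that act(1)[OF that]] assms(4)[OF that act(2)[OF that]] by auto
  have base: "primitive_chain (S i) (closed_loop (p i) (u i))" if i: "i \<in> {1..n}" for i
  proof
    show "finite (S i)" "S i \<noteq> {}" using assms(2)[OF i] by auto
    show "set_pmf (closed_loop (p i) (u i) s) \<subseteq> S i" if "s \<in> S i" for s
      using closed(1)[OF i that] by (simp add: closed_loop_def)
    have "ergodic_chain (S i) (closed_loop (p i) (u i))"
      using assms(5)[OF i] assms(7) i by blast
    with \<open>finite (S i)\<close> show "\<exists>m. \<forall>x\<in>S i. \<forall>y\<in>S i. y \<in> set_pmf (n_step (closed_loop (p i) (u i)) m x)"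
      by (rule ergodic_chain_primitive)
  qed
  have two: "two_policies (S i) (p i) (u i) (u' i)" if i: "i \<in> {1..n}" for i
    using base[OF i] closed(2)[OF i] by (rule two_policies.intro)
  have team: "team n S A p \<nu> (mixed_policy u u' \<delta>)" if \<delta>: "0 \<le> \<delta>" "\<delta> < 1" for \<delta>
  proof (rule team.intro)
    show "finite (A i)" if "i \<in> {1..n}" for i using assms(3)[OF that] by simp
    show "set_pmf (mixed_policy u u' \<delta> i s) \<subseteq> A i" if "i \<in> {1..n}" "s \<in> S i" for i s
      using set_randomize[of "u i" "u' i" \<delta> s] act[OF that] unfolding mixed_policy_eq by auto
    show "primitive_chain (S i) (induced_chain (p i) (mixed_policy u u' \<delta> i))" if "i \<in> {1..n}" for i
      unfolding mixed_policy_eq by (rule two_policies.primitive_chain_randomize[OF two[OF that] \<delta>])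
  qed (use assms(4,6) in auto)
  define avg where "avg i f \<delta> = long_run_average (S i) (p i) (randomize (u i) (u' i) \<delta>) f" for i f \<delta>
  define m where "m \<delta> = team_mean n p r \<nu> (mixed_policy u u' \<delta>)" for \<delta>
  have "mixed_policy u u' 0 = deterministic_policy u"
    by (simp add: fun_eq_iff mixed_policy_eq randomize_0 deterministic_policy_def)
  then have m0: "m 0 = \<mu>" by (simp add: m_def assms(9))
  have m: "m \<delta> = 1 / real n * (\<Sum>i=1..n. avg i (r i) \<delta>)" if "0 \<le> \<delta>" "\<delta> < 1" for \<delta>
    using team.team_mean_eq[OF team[OF that], of r] by (simp add: m_def avg_def mixed_policy_eq)
  \<comment> \<open>The cross terms of the expansion sum to \<open>- 2 n (m \<delta> - \<mu>)\<^sup>2\<close>, because \<open>n * m \<delta>\<close> is the sum of the players' means.\<close>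
  have variance: "team_variance n p r \<nu> (mixed_policy u u' \<delta>) =
      (\<Sum>i=1..n. avg i (\<lambda>s a. (r i s a - \<mu>)\<^sup>2) \<delta>) - real n * (m \<delta> - \<mu>)\<^sup>2"
    if \<delta>: "0 \<le> \<delta>" "\<delta> < 1" for \<delta>
  proof -
    have "team_variance n p r \<nu> (mixed_policy u u' \<delta>) =
        (\<Sum>i=1..n. avg i (\<lambda>s a. (r i s a - m \<delta>)\<^sup>2) \<delta>)"
      using team.team_variance_eq[OF team[OF \<delta>], of r] by (simp add: m_def avg_def mixed_policy_eq)
    also have "\<dots> = (\<Sum>i=1..n. avg i (\<lambda>s a. (r i s a - \<mu>)\<^sup>2) \<delta>
        - 2 * (m \<delta> - \<mu>) * (avg i (r i) \<delta> - \<mu>) + (m \<delta> - \<mu>)\<^sup>2)"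
      unfolding avg_def by (intro sum.cong refl two_policies.long_run_average_square two \<delta>)
    also have "\<dots> = (\<Sum>i=1..n. avg i (\<lambda>s a. (r i s a - \<mu>)\<^sup>2) \<delta>)
        - 2 * (m \<delta> - \<mu>) * ((\<Sum>i=1..n. avg i (r i) \<delta>) - real n * \<mu>) + real n * (m \<delta> - \<mu>)\<^sup>2"
      by (simp add: sum.distrib sum_subtractf flip: sum_distrib_left)
    also have "(\<Sum>i=1..n. avg i (r i) \<delta>) = real n * m \<delta>"
      using m[OF \<delta>] \<open>1 \<le> n\<close> by simp
    finally show ?thesis by (simp add: power2_eq_square algebra_simps)
  qed
  let ?D = "\<Sum>i=1..n. \<Sum>s\<in>S i. pmf (stationary_dist (S i) (closed_loop (p i) (u i))) s *
         ((\<Sum>s'\<in>S i. (pmf (closed_loop (p i) (u' i) s) s' - pmf (closed_loop (p i) (u i) s) s')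
              * potential (p i) (r i) (u i) \<mu> s')
          + (r i s (u' i s) - \<mu>)\<^sup>2 - (r i s (u i s) - \<mu>)\<^sup>2)"
  have main: "((\<lambda>\<delta>. \<Sum>i=1..n. avg i (\<lambda>s a. (r i s a - \<mu>)\<^sup>2) \<delta>) has_real_derivative ?D) (at 0 within {0..1})"
  proof (rule DERIV_sum)
    fix i assume i: "i \<in> {1..n}"
    note potential = potential_poisson[OF base[OF i], where \<rho>="r i" and y=\<mu>]
    interpret two_policies "S i" "p i" "u i" "u' i" by (rule two[OF i])
    show "(avg i (\<lambda>s a. (r i s a - \<mu>)\<^sup>2) has_real_derivative
       (\<Sum>s\<in>S i. pmf (stationary_dist (S i) (closed_loop (p i) (u i))) s *
         ((\<Sum>s'\<in>S i. (pmf (closed_loop (p i) (u' i) s) s' - pmf (closed_loop (p i) (u i) s) s')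
              * potential (p i) (r i) (u i) \<mu> s')
          + (r i s (u' i s) - \<mu>)\<^sup>2 - (r i s (u i s) - \<mu>)\<^sup>2))) (at 0 within {0..1})"
      unfolding avg_def using long_run_average_derivative[where f="\<lambda>s a. (r i s a - \<mu>)\<^sup>2", OF potential]
      unfolding integral_advantage .
  qed
  have "\<exists>D. ((\<lambda>\<delta>. avg i (r i) \<delta>) has_real_derivative D) (at 0 within {0..1})" if "i \<in> {1..n}" for i
    unfolding avg_def by (rule two_policies.long_run_average_differentiable[OF two[OF that]])
  then obtain d where d: "\<And>i. i \<in> {1..n} \<Longrightarrow> (avg i (r i) has_real_derivative d i) (at 0 within {0..1})"
    by metis
  \<comment> \<open>The formula for \<open>m\<close> is established for \<open>\<delta> < 1\<close> only; \<open>a\<close> extends it to all \<open>\<delta>\<close>, so that the derivative rules apply to it.\<close>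
  define a where "a \<delta> = 1 / real n * (\<Sum>i=1..n. avg i (r i) \<delta>)" for \<delta>
  have a: "(a has_real_derivative (1 / real n * (\<Sum>i=1..n. d i))) (at 0 within {0..1})"
    unfolding a_def using d by (intro DERIV_cmult DERIV_sum)
  have a0: "a 0 = \<mu>" using m[of 0] by (simp add: a_def m0)
  have "((\<lambda>\<delta>. (a \<delta> - \<mu>) * (a \<delta> - \<mu>)) has_real_derivative
      (1 / real n * (\<Sum>i=1..n. d i) - 0) * (a 0 - \<mu>) + (1 / real n * (\<Sum>i=1..n. d i) - 0) * (a 0 - \<mu>)) (at 0 within {0..1})"
    by (intro DERIV_mult DERIV_diff a DERIV_const)
  then have square: "((\<lambda>\<delta>. (a \<delta> - \<mu>) * (a \<delta> - \<mu>)) has_real_derivative 0) (at 0 within {0..1})"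
    by (simp add: a0)
  have deriv: "((\<lambda>\<delta>. (\<Sum>i=1..n. avg i (\<lambda>s a. (r i s a - \<mu>)\<^sup>2) \<delta>) - real n * ((a \<delta> - \<mu>) * (a \<delta> - \<mu>)))
      has_real_derivative ?D - real n * 0) (at 0 within {0..1})"
    by (intro DERIV_diff DERIV_cmult main square)
  then have "((\<lambda>\<delta>. (\<Sum>i=1..n. avg i (\<lambda>s a. (r i s a - \<mu>)\<^sup>2) \<delta>) - real n * ((a \<delta> - \<mu>) * (a \<delta> - \<mu>)))
      has_real_derivative ?D) (at 0 within {0..1})"
    by (simp only: mult_zero_right diff_zero)
  then show ?thesis
  proof (rule has_field_derivative_transform_within)
    fix \<delta> :: real assume "\<delta> \<in> {0..1}" "dist \<delta> 0 < 1"
    then have \<delta>: "0 \<le> \<delta>" "\<delta> < 1" by auto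
    show "(\<Sum>i=1..n. avg i (\<lambda>s a. (r i s a - \<mu>)\<^sup>2) \<delta>) - real n * ((a \<delta> - \<mu>) * (a \<delta> - \<mu>)) =
        team_variance n p r \<nu> (mixed_policy u u' \<delta>)"
      using variance[OF \<delta>] m[OF \<delta>] by (simp add: a_def power2_eq_square)
  qed auto
qed

end
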